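(* Let $(X,\delta)$ be a diversity. The following are equivalent: 1. $(X,\delta)$ is hyperconvex; 2. $(X,\delta)$ is injective; 3. there is an isomorphism between $(X,\delta)$ and its tight span $(T_X,\delta_T)$.
   Context: For a set $X$, $\mathcal{P}_{\mathrm{fin}}(X)$ denotes the set of all finite subsets of $X$. A diversity is a pair $(X,\delta)$ where $X$ is a set and $\delta:\mathcal{P}_{\mathrm{fin}}(X)\to\mathbb{R}$ satisfies, for all finite $A,B,C\subseteq X$: (D1) $\delta(A)\ge 0$, and $\delta(A)=0$ if and only if $|A|\le 1$; (D2) if $B\ne\emptyset$ then $\delta(A\cup C)\le\delta(A\cup B)+\delta(B\cup C)$. Given diversities $(Y_1,\delta_1)$ and $(Y_2,\delta_2)$, a map $\phi:Y_1\to Y_2$ is non-expansive if $\delta_1(A)\ge\delta_2(\phi(A))$ for all finite $A\subseteq Y_1$; it is an embedding if it is injective (one-to-one) and $\delta_1(A)=\delta_2(\phi(A))$ for all finite $A\subseteq Y_1$; an isomorphism is a surjective embedding. A diversity $(X,\delta)$ is injective if: given any pair of diversities $(Y_1,\delta_1)$, $(Y_2,\delta_2)$, an embedding $\pi:Y_1\to Y_2$ and a non-expansive map $\phi:Y_1\to X$, there is a non-expansive map $\psi:Y_2\to X$ such that $\phi=\psi\circ\pi$. A diversity $(X,\delta)$ is hyperconvex if for all $r:\mathcal{P}_{\mathrm{fin}}(X)\to\mathbb{R}$ such that $\delta\big(\bigcup_{A\in\mathscr{A}}A\big)\le\sum_{A\in\mathscr{A}}r(A)$ for all finite $\mathscr{A}\subseteq\mathcal{P}_{\mathrm{fin}}(X)$,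 there is $z\in X$ such that $\delta(\{z\}\cup Y)\le r(Y)$ for all finite $Y\subseteq X$. Given a diversity $(X,\delta)$, $P_X$ is the set of all functions $f:\mathcal{P}_{\mathrm{fin}}(X)\to\mathbb{R}$ with $f(\emptyset)=0$ and $\sum_{A\in\mathscr{A}}f(A)\ge\delta\big(\bigcup_{A\in\mathscr{A}}A\big)$ for all finite $\mathscr{A}\subseteq\mathcal{P}_{\mathrm{fin}}(X)$. Write $f\preceq g$ if $f(A)\le g(A)$ for all finite $A\subseteq X$. The tight span $T_X$ is the set of elements of $P_X$ that are minimal with respect to $\preceq$. The function $\delta_T:\mathcal{P}_{\mathrm{fin}}(T_X)\to\mathbb{R}$ is defined by $\delta_T(\emptyset)=0$ and, for finite non-empty $F\subseteq T_X$, $$\delta_T(F)=\sup\left\{\delta\Big(\bigcup_{A\in\mathscr{A}}A\Big)-\sum_{A\in\mathscr{A}}\inf_{f\in F}f(A):\ \mathscr{A}\subseteq\mathcal{P}_{\mathrm{fin}}(X),\ |\mathscr{A}|<\infty\right\}.$$ The pair $(T_X,\delta_T)$ is a diversity. *)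

theory Defs
  imports Complex_Main "HOL-Library.FuncSet"
begin

text \<open>
  A diversity is a carrier \<open>X\<close> with a function \<open>\<delta>\<close> on sets; only the values of \<open>\<delta>\<close> on
  \<^term>\<open>Fpow X\<close>, the finite subsets of \<open>X\<close>, are meaningful. The carrier may be empty.
\<close>

locale diversity =
  fixes X :: "'a set" and \<delta> :: "'a set \<Rightarrow> real"
  assumes nonneg: "A \<in> Fpow X \<Longrightarrow> 0 \<le> \<delta> A"
    and eq_0_iff: "A \<in> Fpow X \<Longrightarrow> \<delta> A = 0 \<longleftrightarrow> card A \<le> 1"
    and triangle: "\<lbrakk>A \<in> Fpow X; B \<in> Fpow X; C \<in> Fpow X; B \<noteq> {}\<rbrakk>
      \<Longrightarrow> \<delta> (A \<union> C) \<le> \<delta> (A \<union> B) + \<delta> (B \<union> C)"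

definition nonexpansive ::
    "'a set \<Rightarrow> ('a set \<Rightarrow> real) \<Rightarrow> 'b set \<Rightarrow> ('b set \<Rightarrow> real) \<Rightarrow> ('a \<Rightarrow> 'b) \<Rightarrow> bool" where
  "nonexpansive Y1 \<delta>1 Y2 \<delta>2 \<phi> \<longleftrightarrow> \<phi> \<in> Y1 \<rightarrow> Y2 \<and> (\<forall>A\<in>Fpow Y1. \<delta>1 A \<ge> \<delta>2 (\<phi> ` A))"

definition diversity_embedding ::
    "'a set \<Rightarrow> ('a set \<Rightarrow> real) \<Rightarrow> 'b set \<Rightarrow> ('b set \<Rightarrow> real) \<Rightarrow> ('a \<Rightarrow> 'b) \<Rightarrow> bool" where
  "diversity_embedding Y1 \<delta>1 Y2 \<delta>2 \<phi> \<longleftrightarrow>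
     \<phi> \<in> Y1 \<rightarrow> Y2 \<and> inj_on \<phi> Y1 \<and> (\<forall>A\<in>Fpow Y1. \<delta>1 A = \<delta>2 (\<phi> ` A))"

definition diversity_isomorphism ::
    "'a set \<Rightarrow> ('a set \<Rightarrow> real) \<Rightarrow> 'b set \<Rightarrow> ('b set \<Rightarrow> real) \<Rightarrow> ('a \<Rightarrow> 'b) \<Rightarrow> bool" where
  "diversity_isomorphism Y1 \<delta>1 Y2 \<delta>2 \<phi> \<longleftrightarrow>
     diversity_embedding Y1 \<delta>1 Y2 \<delta>2 \<phi> \<and> \<phi> ` Y1 = Y2"

text \<open>
  HOL cannot quantify over all types inside a formula, so injectivity takes the type \<open>'u\<close>
  containing the points of the test diversities as a parameter. One type for both test
  diversities is no restriction: see \<open>injective_diversity_extend\<close> below. A type that is too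
  small does not test injectivity (if \<open>'u\<close> has one element, every nonempty \<open>X\<close> passes);
  the type \<open>'v + ('a set \<Rightarrow> real)\<close> with \<open>'v\<close> arbitrary contains copies of every diversity
  over \<open>'v\<close> and also of \<open>X\<close> and its tight span.
\<close>

definition injective_diversity :: "'u itself \<Rightarrow> 'a set \<Rightarrow> ('a set \<Rightarrow> real) \<Rightarrow> bool" where
  "injective_diversity TYPE('u) X \<delta> \<longleftrightarrow>
     (\<forall>(Y1 :: 'u set) \<delta>1 (Y2 :: 'u set) \<delta>2 \<pi> \<phi>.
        diversity Y1 \<delta>1 \<longrightarrow> diversity Y2 \<delta>2 \<longrightarrow>
        diversity_embedding Y1 \<delta>1 Y2 \<delta>2 \<pi> \<longrightarrow> nonexpansive Y1 \<delta>1 X \<delta> \<phi> \<longrightarrow>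
        (\<exists>\<psi>. nonexpansive Y2 \<delta>2 X \<delta> \<psi> \<and> (\<forall>y\<in>Y1. \<phi> y = \<psi> (\<pi> y))))"

definition hyperconvex_diversity :: "'a set \<Rightarrow> ('a set \<Rightarrow> real) \<Rightarrow> bool" where
  "hyperconvex_diversity X \<delta> \<longleftrightarrow>
     (\<forall>r :: 'a set \<Rightarrow> real.
        (\<forall>\<A>\<in>Fpow (Fpow X). \<delta> (\<Union>\<A>) \<le> (\<Sum>A\<in>\<A>. r A)) \<longrightarrow>
        (\<exists>z\<in>X. \<forall>Y\<in>Fpow X. \<delta> ({z} \<union> Y) \<le> r Y))"

text \<open>
  Functions on the finite subsets of \<open>X\<close> are represented by total functions that are
  \<^term>\<open>undefined\<close> elsewhere, so that equality in \<open>P_fun\<close> and \<open>tight_span\<close> is equality on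
  \<^term>\<open>Fpow X\<close>.
\<close>

definition P_fun :: "'a set \<Rightarrow> ('a set \<Rightarrow> real) \<Rightarrow> ('a set \<Rightarrow> real) set" where
  "P_fun X \<delta> = {f \<in> extensional (Fpow X).
     f {} = 0 \<and> (\<forall>\<A>\<in>Fpow (Fpow X). (\<Sum>A\<in>\<A>. f A) \<ge> \<delta> (\<Union>\<A>))}"

definition tight_span :: "'a set \<Rightarrow> ('a set \<Rightarrow> real) \<Rightarrow> ('a set \<Rightarrow> real) set" where
  "tight_span X \<delta> = {f \<in> P_fun X \<delta>.
     \<forall>g\<in>P_fun X \<delta>. (\<forall>A\<in>Fpow X. g A \<le> f A) \<longrightarrow> g = f}"

definition tight_span_div ::
    "'a set \<Rightarrow> ('a set \<Rightarrow> real) \<Rightarrow> ('a set \<Rightarrow> real) set \<Rightarrow> real" where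
  "tight_span_div X \<delta> F =
     (if F = {} then 0
      else (SUP \<A>\<in>Fpow (Fpow X). \<delta> (\<Union>\<A>) - (\<Sum>A\<in>\<A>. INF f\<in>F. f A)))"

text \<open>
  Injectivity tested in a type \<open>'u\<close> yields the extension property for diversities over any
  types \<open>'b\<close> and \<open>'c\<close> that inject into \<open>'u\<close>.
\<close>

lemma diversity_transport:
  fixes Y :: "'b set" and e :: "'b \<Rightarrow> 'u"
  assumes "diversity Y d" and e: "inj e"
  shows "diversity (e ` Y) (\<lambda>A. d (e -` A))"
proof -
  interpret diversity Y d by fact
  have F: "e -` A \<in> Fpow Y" "card (e -` A) = card A" if "A \<in> Fpow (e ` Y)" for A
  proof -
    from that obtain B where B: "A = e ` B" "B \<subseteq> Y" "finite A"
      unfolding Fpow_def by (auto simp: subset_image_iff)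
    have "finite B" using B e by (metis finite_image_iff inj_on_subset subset_UNIV)
    then show "e -` A \<in> Fpow Y" "card (e -` A) = card A"
      using B e by (auto simp: Fpow_def inj_vimage_image_eq card_image inj_on_subset)
  qed
  have ne: "e -` A \<noteq> {}" if "A \<in> Fpow (e ` Y)" "A \<noteq> {}" for A
    using that unfolding Fpow_def by blast
  show ?thesis
    by unfold_locales (use F ne nonneg eq_0_iff triangle in \<open>auto simp: vimage_Un\<close>)
qed

lemma injective_diversity_extend:
  fixes Y1 :: "'b set" and Y2 :: "'c set" and e1 :: "'b \<Rightarrow> 'u" and e2 :: "'c \<Rightarrow> 'u"
  assumes inj: "injective_diversity TYPE('u) X \<delta>" and e1: "inj e1" and e2: "inj e2"
    and Y1: "diversity Y1 \<delta>1" and Y2: "diversity Y2 \<delta>2"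
    and \<pi>: "diversity_embedding Y1 \<delta>1 Y2 \<delta>2 \<pi>" and \<phi>: "nonexpansive Y1 \<delta>1 X \<delta> \<phi>"
  shows "\<exists>\<psi>. nonexpansive Y2 \<delta>2 X \<delta> \<psi> \<and> (\<forall>y\<in>Y1. \<phi> y = \<psi> (\<pi> y))"
proof -
  let ?d1 = "\<lambda>A. \<delta>1 (e1 -` A)" and ?d2 = "\<lambda>A. \<delta>2 (e2 -` A)"
  let ?p = "e2 \<circ> \<pi> \<circ> inv e1" and ?f = "\<phi> \<circ> inv e1"
  have ex: "\<exists>B\<in>Fpow Y1. A = e1 ` B" if "A \<in> Fpow (e1 ` Y1)" for A
  proof -
    from that obtain B where B: "A = e1 ` B" "B \<subseteq> Y1" "finite A"
      unfolding Fpow_def by (auto simp: subset_image_iff)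
    moreover have "finite B" using B e1 by (metis finite_image_iff inj_on_subset subset_UNIV)
    ultimately show ?thesis by (auto simp: Fpow_def)
  qed
  have "diversity_embedding (e1 ` Y1) ?d1 (e2 ` Y2) ?d2 ?p"
    unfolding diversity_embedding_def
  proof (intro conjI ballI)
    show "?p \<in> e1 ` Y1 \<rightarrow> e2 ` Y2"
      using \<pi> e1 by (auto simp: diversity_embedding_def)
    show "inj_on ?p (e1 ` Y1)"
      using \<pi> e1 by (auto simp: diversity_embedding_def inj_eq[OF e2] intro!: inj_onI dest: inj_onD)
    fix A assume "A \<in> Fpow (e1 ` Y1)"
    then obtain B where B: "B \<in> Fpow Y1" "A = e1 ` B" using ex by blast
    have "?p ` A = e2 ` \<pi> ` B" using e1 by (simp add: B image_image)
    then show "?d1 A = ?d2 (?p ` A)"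
      using B \<pi> e1 e2 by (simp add: inj_vimage_image_eq diversity_embedding_def)
  qed
  moreover have "nonexpansive (e1 ` Y1) ?d1 X \<delta> ?f"
    unfolding nonexpansive_def
  proof (intro conjI ballI)
    show "?f \<in> e1 ` Y1 \<rightarrow> X" using \<phi> e1 by (auto simp: nonexpansive_def)
    fix A assume "A \<in> Fpow (e1 ` Y1)"
    then obtain B where B: "B \<in> Fpow Y1" "A = e1 ` B" using ex by blast
    have "?f ` A = \<phi> ` B" using e1 by (simp add: B image_image)
    then show "?d1 A \<ge> \<delta> (?f ` A)"
      using B \<phi> e1 by (simp add: inj_vimage_image_eq nonexpansive_def)
  qed
  ultimately obtain \<psi> where \<psi>: "nonexpansive (e2 ` Y2) ?d2 X \<delta> \<psi>"
      "\<forall>y\<in>e1 ` Y1. ?f y = \<psi> (?p y)"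
    using inj diversity_transport[OF Y1 e1] diversity_transport[OF Y2 e2]
    unfolding injective_diversity_def by meson
  have "nonexpansive Y2 \<delta>2 X \<delta> (\<psi> \<circ> e2)"
    unfolding nonexpansive_def
  proof (intro conjI ballI)
    show "\<psi> \<circ> e2 \<in> Y2 \<rightarrow> X" using \<psi>(1) by (auto simp: nonexpansive_def)
    fix A assume "A \<in> Fpow Y2"
    then have "e2 ` A \<in> Fpow (e2 ` Y2)" by (auto simp: Fpow_def)
    then have "?d2 (e2 ` A) \<ge> \<delta> (\<psi> ` e2 ` A)" using \<psi>(1) by (auto simp: nonexpansive_def)
    then show "\<delta>2 A \<ge> \<delta> ((\<psi> \<circ> e2) ` A)"
      using e2 by (simp add: inj_vimage_image_eq image_comp)
  qed
  moreover have "\<forall>y\<in>Y1. \<phi> y = (\<psi> \<circ> e2) (\<pi> y)" using \<psi>(2) e1 by simp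
  ultimately show ?thesis by blast
qed

end

theory Submission
  imports Defs
begin

text \<open>
  Everything is compared with hyperconvexity. The organising idea is that an element \<open>f\<close> of the
  tight span describes a possible new point: \<open>f A\<close> is the diversity of \<open>A\<close> together with that
  point. The points of \<open>X\<close> itself are described by the functions \<open>A \<mapsto> \<delta> (insert x A)\<close>, and this
  is the canonical embedding of \<open>X\<close> into its tight span. By Zorn's lemma every function admissible
  in the definition of hyperconvexity lies above an element of the tight span
  (\<open>tight_span_below\<close>), so hyperconvexity says that each such virtual point is, up to domination,
  a point of \<open>X\<close>.

  Hyperconvex implies injective: a maximal nonexpansive partial extension is total, because the
  requirements on the image of one further point form an admissible family
  (\<open>hyperconvex_imp_extension\<close>).

  Injective implies hyperconvex: the virtual point of \<open>f\<close> can really be adjoined to \<open>X\<close>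
  (\<open>one_point_extension\<close>), and a nonexpansive retraction back to \<open>X\<close> sends it to a point that
  hyperconvexity asks for (\<open>injective_imp_hyperconvex\<close>).

  Hyperconvex implies isomorphic to the tight span: a point \<open>z\<close> given by hyperconvexity for a
  minimal \<open>f\<close> satisfies \<open>\<delta> (insert z A) \<le> f A\<close>, so minimality makes this an equality and the
  canonical embedding is onto (\<open>hyperconvex_imp_canonical_isomorphism\<close>).

  Isomorphic to the tight span implies hyperconvex: the isomorphism is arbitrary, so the canonical
  embedding gives no direct information. Instead the tight span is itself hyperconvex: an element of
  the tight span of the tight span restricts along the canonical embedding to a function on the
  finite subsets of \<open>X\<close>, and a minimal function below this restriction solves the problem
  (\<open>tight_span_hyperconvex\<close>). Hyperconvexity is then carried back along the isomorphism.
\<close>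

section \<open>Gluing sets in a diversity\<close>

context diversity
begin

lemma empty_eq_0: "\<delta> {} = 0"
  using eq_0_iff[of "{}"] by (simp add: Fpow_def)

lemma singleton_eq_0: "x \<in> X \<Longrightarrow> \<delta> {x} = 0"
  using eq_0_iff[of "{x}"] by (simp add: Fpow_def)

text \<open>
  Adding a single point \<open>c\<close> cannot decrease \<open>\<delta>\<close>: apply the triangle inequality with middle set
  \<open>{c}\<close> and empty third set, and use that \<open>\<delta> {c}\<close> vanishes.
\<close>

lemma mono:
  assumes "A \<subseteq> B" "B \<in> Fpow X"
  shows "\<delta> A \<le> \<delta> B"
proof -
  have "finite B" "B \<subseteq> X" using assms by (auto simp: Fpow_def)
  have "\<delta> A \<le> \<delta> (A \<union> C)" if "finite C" "C \<subseteq> B" for C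
    using that
  proof (induction C)
    case empty
    then show ?case by simp
  next
    case (insert c C)
    have "\<delta> (A \<union> C) \<le> \<delta> (A \<union> C \<union> {c}) + \<delta> ({c} \<union> {})"
      using triangle[of "A \<union> C" "{c}" "{}"] insert.prems insert.hyps assms \<open>finite B\<close>
      by (auto simp: Fpow_def finite_subset)
    moreover have "\<delta> {c} = 0"
      using singleton_eq_0 insert.prems \<open>B \<subseteq> X\<close> by blast
    ultimately show ?case using insert by auto
  qed
  from this[OF \<open>finite B\<close>] assms(1) show ?thesis by (simp add: Un_absorb1)
qed

lemma Un_le:
  assumes "A \<in> Fpow X" "B \<in> Fpow X" "A \<inter> B \<noteq> {}"
  shows "\<delta> (A \<union> B) \<le> \<delta> A + \<delta> B"
proof -
  from assms(3) obtain x where x: "x \<in> A" "x \<in> B" by blast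
  then have "{x} \<in> Fpow X" using assms by (auto simp: Fpow_def)
  from triangle[OF assms(1) this assms(2)] x show ?thesis
    by (simp add: insert_absorb Un_absorb1)
qed

text \<open>
  The form in which the triangle inequality is used below: attaching to \<open>F\<close> sets that meet \<open>F\<close>
  costs at most the sum of their diversities. Empty sets are admitted so that the lemma also covers
  families in which nothing is attached at some indices.
\<close>

lemma glue:
  assumes "finite J" "F \<in> Fpow X"
    and "\<And>j. j \<in> J \<Longrightarrow> C j \<in> Fpow X"
    and "\<And>j. j \<in> J \<Longrightarrow> C j = {} \<or> C j \<inter> F \<noteq> {}"
  shows "\<delta> (F \<union> (\<Union>j\<in>J. C j)) \<le> \<delta> F + (\<Sum>j\<in>J. \<delta> (C j))"
  using assms(1,3,4)
proof (induction J)
  case empty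
  then show ?case by simp
next
  case (insert j J)
  let ?U = "F \<union> (\<Union>j\<in>J. C j)"
  have U: "?U \<in> Fpow X"
    using insert.hyps(1) insert.prems(1) assms(2) by (auto simp: Fpow_def)
  have "\<delta> (?U \<union> C j) \<le> \<delta> ?U + \<delta> (C j)"
  proof (cases "C j = {}")
    case True
    then show ?thesis by (simp add: empty_eq_0)
  next
    case False
    then show ?thesis
      using insert.prems(2)[of j] insert.prems(1)[of j] Un_le[OF U, of "C j"] by blast
  qed
  moreover have "?U \<union> C j = F \<union> (\<Union>j\<in>insert j J. C j)" by blast
  moreover have "\<delta> ?U \<le> \<delta> F + (\<Sum>j\<in>J. \<delta> (C j))"
    using insert by simp
  ultimately show ?case using insert.hyps by simp
qed

lemma star:
  assumes "finite J" "y \<in> X" and B: "\<And>j. j \<in> J \<Longrightarrow> B j \<in> Fpow X"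
  shows "\<delta> (\<Union>j\<in>J. B j) \<le> (\<Sum>j\<in>J. \<delta> (insert y (B j)))"
proof -
  have "\<delta> (\<Union>j\<in>J. B j) \<le> \<delta> ({y} \<union> (\<Union>j\<in>J. insert y (B j)))"
    by (rule mono) (use assms in \<open>auto simp: Fpow_def\<close>)
  also have "\<dots> \<le> \<delta> {y} + (\<Sum>j\<in>J. \<delta> (insert y (B j)))"
    by (rule glue) (use assms in \<open>auto simp: Fpow_def\<close>)
  finally show ?thesis using singleton_eq_0 assms by simp
qed

end

section \<open>The tight span\<close>

lemma P_funD:
  assumes "f \<in> P_fun X \<delta>"
  shows "f \<in> extensional (Fpow X)" "f {} = 0"
    "\<And>\<A>. \<lbrakk>finite \<A>; \<A> \<subseteq> Fpow X\<rbrakk> \<Longrightarrow> \<delta> (\<Union>\<A>) \<le> (\<Sum>A\<in>\<A>. f A)"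
  using assms unfolding P_fun_def by (auto simp: Fpow_def)

lemma tight_spanD:
  assumes "f \<in> tight_span X \<delta>"
  shows "f \<in> P_fun X \<delta>"
    "\<And>g. \<lbrakk>g \<in> P_fun X \<delta>; \<And>A. A \<in> Fpow X \<Longrightarrow> g A \<le> f A\<rbrakk> \<Longrightarrow> g = f"
  using assms unfolding tight_span_def by auto

context diversity
begin

lemma P_fun_nonneg:
  assumes "f \<in> P_fun X \<delta>" "A \<in> Fpow X"
  shows "0 \<le> f A"
  using P_funD(3)[OF assms(1), of "{A}"] nonneg[OF assms(2)] assms by simp

text \<open>
  The defining inequality for \<open>insert B \<A>\<close>. The case \<open>B \<in> \<A>\<close>, where \<open>f B\<close> is counted twice on the
  right, is absorbed by nonnegativity.
\<close>

lemma P_fun_Un: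
  assumes f: "f \<in> P_fun X \<delta>" and "\<A> \<subseteq> Fpow X" "finite \<A>" "B \<in> Fpow X"
  shows "\<delta> (B \<union> \<Union>\<A>) \<le> f B + (\<Sum>A\<in>\<A>. f A)"
proof -
  have "\<delta> (\<Union>(insert B \<A>)) \<le> (\<Sum>A\<in>insert B \<A>. f A)"
    using assms by (intro P_funD(3)[OF f]) auto
  also have "\<dots> \<le> f B + (\<Sum>A\<in>\<A>. f A)"
    using assms P_fun_nonneg[OF f] by (simp add: sum.insert_if)
  finally show ?thesis by simp
qed

lemma P_fun_Un2:
  assumes f: "f \<in> P_fun X \<delta>" and "A \<in> Fpow X" "B \<in> Fpow X"
  shows "\<delta> (A \<union> B) \<le> f A + f B"
  using P_fun_Un[OF f, of "{B}" A] assms by simp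

text \<open>
  The pointwise infimum of a chain. Each defining inequality involves only finitely many sets, and
  on finitely many sets a single member of the chain approximates the infimum simultaneously.
\<close>

lemma P_fun_chain_bound:
  assumes C: "C \<noteq> {}" "C \<subseteq> P_fun X \<delta>"
    and tot: "\<And>f g. \<lbrakk>f \<in> C; g \<in> C\<rbrakk> \<Longrightarrow> (\<forall>A\<in>Fpow X. f A \<le> g A) \<or> (\<forall>A\<in>Fpow X. g A \<le> f A)"
  shows "\<exists>g\<in>P_fun X \<delta>. \<forall>f\<in>C. \<forall>A\<in>Fpow X. g A \<le> f A"
proof -
  define g where "g = restrict (\<lambda>A. INF f\<in>C. f A) (Fpow X)"
  have bdd: "bdd_below ((\<lambda>f. f A) ` C)" if "A \<in> Fpow X" for A
    using that C P_fun_nonneg by (intro bdd_belowI[of _ 0]) auto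
  have le: "g A \<le> f A" if "f \<in> C" "A \<in> Fpow X" for f A
    using cINF_lower[OF bdd[OF that(2)] that(1)] that(2) by (simp add: g_def)
  have approx: "\<exists>f\<in>C. \<forall>A\<in>\<A>. f A < g A + e" if "finite \<A>" "\<A> \<subseteq> Fpow X" "e > 0" for \<A> e
    using that(1,2)
  proof (induction \<A>)
    case empty
    then show ?case using C by auto
  next
    case (insert A \<A>)
    then obtain f1 where f1: "f1 \<in> C" "\<forall>A\<in>\<A>. f1 A < g A + e" by auto
    have "(INF f\<in>C. f A) < g A + e" using insert.prems \<open>e > 0\<close> by (simp add: g_def)
    then obtain f2 where f2: "f2 \<in> C" "f2 A < g A + e"
      using bdd[of A] C insert.prems by (auto simp: cINF_less_iff)
    from tot[OF f1(1) f2(1)] show ?case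
    proof
      assume "\<forall>A\<in>Fpow X. f1 A \<le> f2 A"
      then have "f1 A < g A + e" using f2(2) insert.prems by (meson insert_subset le_less_trans)
      then show ?thesis using f1 by auto
    next
      assume *: "\<forall>A\<in>Fpow X. f2 A \<le> f1 A"
      have "f2 B < g B + e" if "B \<in> \<A>" for B
        using * f1(2) that insert.prems by (meson insert_subset le_less_trans subsetD)
      then show ?thesis using f2 by auto
    qed
  qed
  have "g \<in> P_fun X \<delta>"
    unfolding P_fun_def
  proof (intro CollectI conjI ballI)
    show "g \<in> extensional (Fpow X)" by (simp add: g_def)
    have "(\<lambda>f. f {}) ` C = {0}" using C P_funD(2) by fastforce
    then show "g {} = 0" by (simp add: g_def Fpow_def)
    fix \<A> assume "\<A> \<in> Fpow (Fpow X)"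
    then have \<A>: "finite \<A>" "\<A> \<subseteq> Fpow X" by (auto simp: Fpow_def)
    show "\<delta> (\<Union>\<A>) \<le> (\<Sum>A\<in>\<A>. g A)"
    proof (rule field_le_epsilon)
      fix e :: real assume "e > 0"
      define d where "d = e / (real (card \<A>) + 1)"
      have "d > 0" using \<open>e > 0\<close> by (simp add: d_def add_nonneg_pos)
      from approx[OF \<A> this] obtain f where f: "f \<in> C" "\<forall>A\<in>\<A>. f A < g A + d" by blast
      have "\<delta> (\<Union>\<A>) \<le> (\<Sum>A\<in>\<A>. f A)" using f C \<A> by (intro P_funD(3)) auto
      also have "\<dots> \<le> (\<Sum>A\<in>\<A>. g A + d)" using f by (intro sum_mono) force
      also have "\<dots> = (\<Sum>A\<in>\<A>. g A) + card \<A> * d" by (simp add: sum.distrib)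
      also have "card \<A> * d \<le> e" using \<open>e > 0\<close> by (simp add: d_def field_simps)
      finally show "\<delta> (\<Union>\<A>) \<le> (\<Sum>A\<in>\<A>. g A) + e" by simp
    qed
  qed
  then show ?thesis using le by blast
qed

lemma tight_span_below_P_fun:
  assumes r: "r \<in> P_fun X \<delta>"
  shows "\<exists>f\<in>tight_span X \<delta>. \<forall>A\<in>Fpow X. f A \<le> r A"
proof -
  define S where "S = {f \<in> P_fun X \<delta>. \<forall>A\<in>Fpow X. f A \<le> r A}"
  define P where "P = (\<lambda>f g :: 'a set \<Rightarrow> real. \<forall>A\<in>Fpow X. g A \<le> f A)"
  have "\<exists>m\<in>S. \<forall>a\<in>S. P m a \<longrightarrow> a = m"
  proof (rule predicate_Zorn)
    show "partial_order_on S (relation_of P S)"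
    proof (rule partial_order_on_relation_ofI)
      show "P a a" for a by (simp add: P_def)
      show "P a c" if "P a b" "P b c" for a b c
        using that unfolding P_def by (meson order_trans)
      show "a = b" if "a \<in> S" "b \<in> S" "P a b" "P b a" for a b
      proof (rule extensionalityI[of _ "Fpow X"])
        show "a \<in> extensional (Fpow X)" "b \<in> extensional (Fpow X)"
          using that P_funD(1) by (auto simp: S_def)
        show "a A = b A" if "A \<in> Fpow X" for A
          using that \<open>P a b\<close> \<open>P b a\<close> by (simp add: P_def order_antisym)
      qed
    qed
    fix C assume C: "C \<in> Chains (relation_of P S)"
    show "\<exists>u\<in>S. \<forall>a\<in>C. P a u"
    proof (cases "C = {}")
      case True
      then show ?thesis using r by (auto simp: S_def)
    next
      case False
      have CS: "C \<subseteq> S" using C by (auto simp: Chains_def relation_of_def)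
      have "P f g \<or> P g f" if "f \<in> C" "g \<in> C" for f g
        using C that by (auto simp: Chains_def relation_of_def)
      then have "\<exists>g\<in>P_fun X \<delta>. \<forall>f\<in>C. \<forall>A\<in>Fpow X. g A \<le> f A"
        using False CS unfolding P_def S_def by (intro P_fun_chain_bound) blast+
      then obtain g where g: "g \<in> P_fun X \<delta>" "\<forall>f\<in>C. \<forall>A\<in>Fpow X. g A \<le> f A" by blast
      obtain f where "f \<in> C" using False by blast
      then have "g \<in> S" using g CS by (fastforce simp: S_def)
      then show ?thesis using g by (auto simp: P_def)
    qed
  qed
  then obtain m where m: "m \<in> S" "\<And>a. \<lbrakk>a \<in> S; P m a\<rbrakk> \<Longrightarrow> a = m" by blast
  have "m \<in> tight_span X \<delta>"
    unfolding tight_span_def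
  proof (intro CollectI conjI ballI impI)
    show "m \<in> P_fun X \<delta>" using m by (simp add: S_def)
    fix g assume g: "g \<in> P_fun X \<delta>" "\<forall>A\<in>Fpow X. g A \<le> m A"
    then have "g \<in> S" using m(1) by (fastforce simp: S_def)
    then show "g = m" using g m(2) by (simp add: P_def)
  qed
  then show ?thesis using m by (auto simp: S_def)
qed

text \<open>
  A function admissible for hyperconvexity need not vanish at the empty set. Its value there is
  nonnegative, and lowering it to \<open>0\<close> keeps all inequalities because the empty set contributes
  nothing to a union.
\<close>

lemma tight_span_below:
  assumes r: "\<forall>\<A>\<in>Fpow (Fpow X). \<delta> (\<Union>\<A>) \<le> (\<Sum>A\<in>\<A>. r A)"
  shows "\<exists>f\<in>tight_span X \<delta>. \<forall>A\<in>Fpow X. f A \<le> r A"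
proof -
  define r' where "r' = restrict (r({} := 0)) (Fpow X)"
  have "{{}} \<in> Fpow (Fpow X)" by (simp add: Fpow_def)
  with r have "\<delta> (\<Union>{{}}) \<le> (\<Sum>A\<in>{{}}. r A)" by blast
  then have r0: "0 \<le> r {}" by (simp add: empty_eq_0)
  have "r' \<in> P_fun X \<delta>"
    unfolding P_fun_def
  proof (intro CollectI conjI ballI)
    show "r' \<in> extensional (Fpow X)" "r' {} = 0" by (simp_all add: r'_def Fpow_def)
    fix \<A> assume \<A>: "\<A> \<in> Fpow (Fpow X)"
    then have "\<A> - {{}} \<in> Fpow (Fpow X)" by (auto simp: Fpow_def)
    with r have "\<delta> (\<Union>(\<A> - {{}})) \<le> (\<Sum>A\<in>\<A> - {{}}. r A)" by blast
    also have "\<dots> = (\<Sum>A\<in>\<A> - {{}}. r' A)"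
      using \<A> by (intro sum.cong) (auto simp: r'_def Fpow_def)
    also have "\<dots> = (\<Sum>A\<in>\<A>. r' A)"
      using \<A> by (intro sum.mono_neutral_left) (auto simp: r'_def Fpow_def)
    also have "\<Union>(\<A> - {{}}) = \<Union>\<A>" by blast
    finally show "\<delta> (\<Union>\<A>) \<le> (\<Sum>A\<in>\<A>. r' A)" .
  qed
  from tight_span_below_P_fun[OF this] obtain f
    where f: "f \<in> tight_span X \<delta>" "\<forall>A\<in>Fpow X. f A \<le> r' A" by blast
  moreover have "r' A \<le> r A" if "A \<in> Fpow X" for A
    using that r0 by (simp add: r'_def)
  ultimately show ?thesis by (meson order_trans)
qed

text \<open>
  Minimality made quantitative: for each \<open>A\<close> there is a defining inequality containing \<open>A\<close> that is
  tight up to \<open>e\<close>. Otherwise the value at \<open>A\<close> alone could be lowered by \<open>e\<close> without leaving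
  \<open>P_fun X \<delta>\<close>. All further properties of the tight span come from this lemma.
\<close>

lemma tight_span_approx_family:
  assumes f: "f \<in> tight_span X \<delta>" and A: "A \<in> Fpow X" and e: "e > 0"
  shows "\<exists>\<A>. finite \<A> \<and> \<A> \<subseteq> Fpow X \<and> f A < \<delta> (A \<union> \<Union>\<A>) - (\<Sum>B\<in>\<A>. f B) + e"
proof (rule ccontr)
  assume no: "\<not> ?thesis"
  have neg: "\<delta> (A \<union> \<Union>\<A>) \<le> (f A - e) + (\<Sum>B\<in>\<A>. f B)" if "finite \<A>" "\<A> \<subseteq> Fpow X" for \<A>
  proof -
    have "\<not> f A < \<delta> (A \<union> \<Union>\<A>) - (\<Sum>B\<in>\<A>. f B) + e"
      using no that by blast
    then show ?thesis by linarith
  qed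
  note fP = tight_spanD(1)[OF f]
  \<comment> \<open>the value at the empty set is fixed to be \<open>0\<close> and must not be lowered\<close>
  have "A \<noteq> {}"
    using neg[of "{}"] e P_funD(2)[OF fP] empty_eq_0 by auto
  define g where "g = f(A := f A - e)"
  have "g \<in> P_fun X \<delta>"
    unfolding P_fun_def
  proof (intro CollectI conjI ballI)
    show "g \<in> extensional (Fpow X)"
      using P_funD(1)[OF fP] A by (auto simp: g_def extensional_def)
    show "g {} = 0" using P_funD(2)[OF fP] \<open>A \<noteq> {}\<close> by (simp add: g_def)
    fix \<A> assume "\<A> \<in> Fpow (Fpow X)"
    then have \<A>: "finite \<A>" "\<A> \<subseteq> Fpow X" by (auto simp: Fpow_def)
    show "\<delta> (\<Union>\<A>) \<le> (\<Sum>A\<in>\<A>. g A)"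
    proof (cases "A \<in> \<A>")
      case True
      have "\<delta> (A \<union> \<Union>(\<A> - {A})) \<le> (f A - e) + (\<Sum>B\<in>\<A> - {A}. f B)"
        using \<A> by (intro neg) auto
      also have "\<dots> = (\<Sum>A\<in>\<A>. g A)"
        using True \<A> by (simp add: sum.remove[of \<A> A] g_def)
      also have "A \<union> \<Union>(\<A> - {A}) = \<Union>\<A>" using True by blast
      finally show ?thesis .
    next
      case False
      then have "(\<Sum>A\<in>\<A>. g A) = (\<Sum>A\<in>\<A>. f A)" by (intro sum.cong) (auto simp: g_def)
      then show ?thesis using P_funD(3)[OF fP] \<A> by simp
    qed
  qed
  moreover have "g B \<le> f B" for B using e by (simp add: g_def)
  ultimately have "g = f" using tight_spanD(2)[OF f] by blast
  then have "g A = f A" by simp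
  then show False using e by (simp add: g_def)
qed

text \<open>
  Take a nearly tight inequality for \<open>\<Union>\<A>\<close> and replace the single set \<open>\<Union>\<A>\<close> by the family \<open>\<A>\<close>.
  The total union is unchanged, so the defining inequality of the new family gives the bound.
\<close>

lemma tight_span_Union_le:
  assumes f: "f \<in> tight_span X \<delta>" and \<A>: "finite \<A>" "\<A> \<subseteq> Fpow X"
  shows "f (\<Union>\<A>) \<le> (\<Sum>A\<in>\<A>. f A)"
proof (rule field_le_epsilon)
  fix e :: real assume "e > 0"
  note fP = tight_spanD(1)[OF f]
  have "\<Union>\<A> \<in> Fpow X" using \<A> by (auto simp: Fpow_def)
  from tight_span_approx_family[OF f this \<open>e > 0\<close>] obtain \<B> where
    \<B>: "finite \<B>" "\<B> \<subseteq> Fpow X" "f (\<Union>\<A>) < \<delta> (\<Union>\<A> \<union> \<Union>\<B>) - (\<Sum>B\<in>\<B>. f B) + e" by blast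
  have "\<delta> (\<Union>(\<A> \<union> \<B>)) \<le> (\<Sum>A\<in>\<A> \<union> \<B>. f A)"
    using \<A> \<B> by (intro P_funD(3)[OF fP]) auto
  also have "\<dots> \<le> (\<Sum>A\<in>\<A>. f A) + (\<Sum>B\<in>\<B>. f B)"
    using sum.union_inter[of \<A> \<B> f] sum_nonneg[of "\<A> \<inter> \<B>" f] P_fun_nonneg[OF fP] \<A> \<B>
    by (metis (no_types, lifting) IntD1 le_add_same_cancel1 subsetD)
  finally show "f (\<Union>\<A>) \<le> (\<Sum>A\<in>\<A>. f A) + e" using \<B> by (simp add: Union_Un_distrib)
qed

text \<open>
  By subadditivity the family in the nearly tight inequality can be merged into one set. In other
  words \<open>f A\<close> is the supremum of \<open>\<delta> (A \<union> B) - f B\<close> over finite \<open>B\<close>.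
\<close>

lemma tight_span_approx:
  assumes f: "f \<in> tight_span X \<delta>" and A: "A \<in> Fpow X" and e: "e > 0"
  shows "\<exists>B\<in>Fpow X. f A < \<delta> (A \<union> B) - f B + e"
proof -
  from tight_span_approx_family[OF assms] obtain \<B> where
    \<B>: "finite \<B>" "\<B> \<subseteq> Fpow X" "f A < \<delta> (A \<union> \<Union>\<B>) - (\<Sum>B\<in>\<B>. f B) + e" by blast
  then have "\<Union>\<B> \<in> Fpow X" by (auto simp: Fpow_def)
  moreover have "f A < \<delta> (A \<union> \<Union>\<B>) - f (\<Union>\<B>) + e"
    using \<B> tight_span_Union_le[OF f \<B>(1,2)] by simp
  ultimately show ?thesis by blast
qed

text \<open>
  The counterpart of \<open>glue\<close> for a virtual point: it reduces to \<open>glue\<close> for \<open>F \<union> B\<close>, where \<open>B\<close>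
  is the set that nearly realises \<open>f A\<close>.
\<close>

lemma tight_span_glue:
  assumes f: "f \<in> tight_span X \<delta>" and J: "finite J" and F: "F \<in> Fpow X"
    and C: "\<And>j. j \<in> J \<Longrightarrow> C j \<in> Fpow X" "\<And>j. j \<in> J \<Longrightarrow> C j \<inter> F \<noteq> {}"
    and A: "A \<subseteq> F \<union> (\<Union>j\<in>J. C j)"
  shows "f A \<le> f F + (\<Sum>j\<in>J. \<delta> (C j))"
proof (rule field_le_epsilon)
  fix e :: real assume "e > 0"
  let ?U = "F \<union> (\<Union>j\<in>J. C j)"
  have U: "?U \<in> Fpow X" using J F C by (auto simp: Fpow_def)
  then have AX: "A \<in> Fpow X" using A by (auto simp: Fpow_def intro: finite_subset)
  from tight_span_approx[OF f AX \<open>e > 0\<close>] obtain B where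
    B: "B \<in> Fpow X" "f A < \<delta> (A \<union> B) - f B + e" by blast
  have "\<delta> (A \<union> B) \<le> \<delta> ((F \<union> B) \<union> (\<Union>j\<in>J. C j))"
    using A B U by (intro mono) (auto simp: Fpow_def)
  also have "\<dots> \<le> \<delta> (F \<union> B) + (\<Sum>j\<in>J. \<delta> (C j))"
    using C F B J by (intro glue) (auto simp: Fpow_def, blast)
  also have "\<delta> (F \<union> B) \<le> f F + f B"
    using P_fun_Un2[OF tight_spanD(1)[OF f] F B(1)] .
  finally show "f A \<le> f F + (\<Sum>j\<in>J. \<delta> (C j)) + e" using B by simp
qed

lemma tight_span_mono:
  assumes "f \<in> tight_span X \<delta>" "A \<subseteq> B" "B \<in> Fpow X"
  shows "f A \<le> f B"
  using tight_span_glue[of f "{}" B _ A] assms by simp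

lemma tight_span_Un_le:
  assumes "f \<in> tight_span X \<delta>" "A \<in> Fpow X" "B \<in> Fpow X"
  shows "f (A \<union> B) \<le> f A + f B"
proof (cases "A = B")
  case True
  then show ?thesis using P_fun_nonneg[OF tight_spanD(1)] assms by simp
next
  case False
  then show ?thesis using tight_span_Union_le[of f "{A, B}"] assms by simp
qed

end

section \<open>The canonical embedding\<close>

definition canonical_map :: "'a set \<Rightarrow> ('a set \<Rightarrow> real) \<Rightarrow> 'a \<Rightarrow> 'a set \<Rightarrow> real" where
  "canonical_map X \<delta> x = restrict (\<lambda>A. \<delta> (insert x A)) (Fpow X)"

text \<open>
  Over a finite set \<open>F\<close> each infimum is attained, so the terms of the supremum defining
  \<open>tight_span_div\<close> are controlled by selections \<open>s\<close> of one function in \<open>F\<close> for each set in \<open>\<A>\<close>.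
\<close>

lemma tight_span_div_term_le:
  fixes \<delta> :: "'a set \<Rightarrow> real"
  assumes F: "finite F" "F \<noteq> {}" and \<A>: "\<A> \<in> Fpow (Fpow X)"
    and le: "\<And>s. s ` \<A> \<subseteq> F \<Longrightarrow> \<delta> (\<Union>\<A>) \<le> c + (\<Sum>A\<in>\<A>. s A A)"
  shows "\<delta> (\<Union>\<A>) - (\<Sum>A\<in>\<A>. INF f\<in>F. f A) \<le> c"
proof -
  have "\<exists>f\<in>F. f A = (INF f\<in>F. f A)" for A
  proof -
    have "(INF f\<in>F. f A) = Min ((\<lambda>f. f A) ` F)" using F by (intro cInf_eq_Min) auto
    also have "\<dots> \<in> (\<lambda>f. f A) ` F" using F by (intro Min_in) auto
    finally show ?thesis by auto
  qed
  then obtain s where s: "\<And>A. s A \<in> F" "\<And>A. s A A = (INF f\<in>F. f A)" by metis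
  have "\<delta> (\<Union>\<A>) \<le> c + (\<Sum>A\<in>\<A>. s A A)"
    using s(1) by (intro le) auto
  then show ?thesis using s(2) by simp
qed

lemma tight_span_div_leI:
  fixes \<delta> :: "'a set \<Rightarrow> real"
  assumes F: "finite F" "F \<noteq> {}"
    and le: "\<And>\<A> s. \<lbrakk>finite \<A>; \<A> \<subseteq> Fpow X; s ` \<A> \<subseteq> F\<rbrakk> \<Longrightarrow> \<delta> (\<Union>\<A>) \<le> c + (\<Sum>A\<in>\<A>. s A A)"
  shows "tight_span_div X \<delta> F \<le> c"
proof -
  have "(SUP \<A>\<in>Fpow (Fpow X). \<delta> (\<Union>\<A>) - (\<Sum>A\<in>\<A>. INF f\<in>F. f A)) \<le> c"
  proof (rule cSUP_least)
    show "Fpow (Fpow X) \<noteq> {}" by (auto simp: Fpow_def)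
    show "\<delta> (\<Union>\<A>) - (\<Sum>A\<in>\<A>. INF f\<in>F. f A) \<le> c" if "\<A> \<in> Fpow (Fpow X)" for \<A>
      using that F le by (intro tight_span_div_term_le) (auto simp: Fpow_def)
  qed
  then show ?thesis using F by (simp add: tight_span_div_def)
qed

context diversity
begin

lemma canonical_map_P_fun:
  assumes "x \<in> X"
  shows "canonical_map X \<delta> x \<in> P_fun X \<delta>"
  unfolding P_fun_def
proof (intro CollectI conjI ballI)
  show "canonical_map X \<delta> x \<in> extensional (Fpow X)" "canonical_map X \<delta> x {} = 0"
    using singleton_eq_0[OF assms] by (simp_all add: canonical_map_def Fpow_def)
  fix \<A> assume \<A>: "\<A> \<in> Fpow (Fpow X)"
  then have "\<delta> (\<Union>A\<in>\<A>. A) \<le> (\<Sum>A\<in>\<A>. \<delta> (insert x A))"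
    using assms by (intro star) (auto simp: Fpow_def)
  also have "\<dots> = (\<Sum>A\<in>\<A>. canonical_map X \<delta> x A)"
    using \<A> by (intro sum.cong) (auto simp: canonical_map_def Fpow_def)
  finally show "\<delta> (\<Union>\<A>) \<le> (\<Sum>A\<in>\<A>. canonical_map X \<delta> x A)" by simp
qed

text \<open>
  A virtual point at distance \<open>0\<close> from an actual point \<open>x\<close> can be replaced by \<open>x\<close>.
\<close>

lemma P_fun_zero_le:
  assumes f: "f \<in> P_fun X \<delta>" and x: "x \<in> X" "f {x} \<le> 0" and A: "A \<in> Fpow X"
  shows "\<delta> (insert x A) \<le> f A"
  using P_fun_Un2[OF f, of "{x}" A] assms by (simp add: Fpow_def)

text \<open>
  A competitor \<open>g\<close> below the image of \<open>x\<close> has \<open>g {x} \<le> 0\<close>, and then the defining inequality for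
  \<open>{x}\<close> and \<open>A\<close> forces \<open>g A\<close> to be at least \<open>\<delta> (insert x A)\<close>.
\<close>

lemma canonical_map_tight_span:
  assumes x: "x \<in> X"
  shows "canonical_map X \<delta> x \<in> tight_span X \<delta>"
  unfolding tight_span_def
proof (intro CollectI conjI ballI impI)
  let ?k = "canonical_map X \<delta> x"
  show "?k \<in> P_fun X \<delta>" using canonical_map_P_fun[OF x] .
  fix g assume g: "g \<in> P_fun X \<delta>" "\<forall>A\<in>Fpow X. g A \<le> ?k A"
  have x': "{x} \<in> Fpow X" using x by (simp add: Fpow_def)
  with g(2) have "g {x} \<le> ?k {x}" by blast
  then have "g {x} \<le> 0" using x' singleton_eq_0[OF x] by (simp add: canonical_map_def)
  note ge = P_fun_zero_le[OF g(1) x this]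
  show "g = ?k"
  proof (rule extensionalityI[of _ "Fpow X"])
    show "g \<in> extensional (Fpow X)" using P_funD(1)[OF g(1)] .
    show "?k \<in> extensional (Fpow X)" by (simp add: canonical_map_def)
    show "g A = ?k A" if "A \<in> Fpow X" for A
      using g(2) ge[OF that] that by (intro order_antisym) (auto simp: canonical_map_def)
  qed
qed

text \<open>
  The combinatorial core of \<open>\<delta>\<^sub>T ({f} \<union> \<kappa> ` A) \<le> f A\<close>, where \<open>\<kappa>\<close> is the canonical map. Sets for
  which \<open>f\<close> is selected are handled together with \<open>A\<close> by the defining inequality of \<open>f\<close>. A set \<open>B\<close>
  for which the image of some \<open>x \<in> A\<close> is selected is glued to \<open>A\<close> through the point \<open>x\<close>.
\<close>

lemma canonical_selection_le:
  assumes f: "f \<in> tight_span X \<delta>" and A: "A \<in> Fpow X"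
    and \<A>: "finite \<A>" "\<A> \<subseteq> Fpow X"
    and s: "s ` \<A> \<subseteq> insert f (canonical_map X \<delta> ` A)"
  shows "\<delta> (\<Union>\<A>) \<le> f A + (\<Sum>B\<in>\<A>. s B B)"
proof -
  define \<A>1 where "\<A>1 = {B\<in>\<A>. s B = f}"
  define \<A>2 where "\<A>2 = \<A> - \<A>1"
  have sub: "finite \<A>1" "finite \<A>2" "\<A>1 \<subseteq> Fpow X" "\<A>2 \<subseteq> Fpow X" "\<A> = \<A>1 \<union> \<A>2" "\<A>1 \<inter> \<A>2 = {}"
    using \<A> by (auto simp: \<A>1_def \<A>2_def)
  have "\<exists>x\<in>A. s B = canonical_map X \<delta> x" if "B \<in> \<A>2" for B
    using that s by (auto simp: \<A>1_def \<A>2_def)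
  then obtain x where x: "\<And>B. B \<in> \<A>2 \<Longrightarrow> x B \<in> A \<and> s B = canonical_map X \<delta> (x B)" by metis
  have ins: "insert (x B) B \<in> Fpow X" if "B \<in> \<A>2" for B
    using that x[OF that] A sub by (auto simp: Fpow_def)
  have "\<delta> (\<Union>\<A>) \<le> \<delta> ((A \<union> \<Union>\<A>1) \<union> (\<Union>B\<in>\<A>2. insert (x B) B))"
    using sub A ins by (intro mono) (auto simp: Fpow_def)
  also have "\<dots> \<le> \<delta> (A \<union> \<Union>\<A>1) + (\<Sum>B\<in>\<A>2. \<delta> (insert (x B) B))"
    using sub A ins x by (intro glue) (auto simp: Fpow_def)
  also have "\<delta> (A \<union> \<Union>\<A>1) \<le> f A + (\<Sum>B\<in>\<A>1. f B)"
    using sub A by (intro P_fun_Un[OF tight_spanD(1)[OF f]]) auto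
  also have "(\<Sum>B\<in>\<A>1. f B) = (\<Sum>B\<in>\<A>1. s B B)"
    by (intro sum.cong) (auto simp: \<A>1_def)
  also have "(\<Sum>B\<in>\<A>2. \<delta> (insert (x B) B)) = (\<Sum>B\<in>\<A>2. s B B)"
    using x sub by (intro sum.cong) (auto simp: canonical_map_def)
  also have "f A + (\<Sum>B\<in>\<A>1. s B B) + (\<Sum>B\<in>\<A>2. s B B) = f A + (\<Sum>B\<in>\<A>. s B B)"
    using sub by (simp add: sum.union_disjoint)
  finally show "\<delta> (\<Union>\<A>) \<le> f A + (\<Sum>B\<in>\<A>. s B B)" by simp
qed

lemma tight_span_div_canonical_le:
  assumes f: "f \<in> tight_span X \<delta>" and A: "A \<in> Fpow X"
  shows "tight_span_div X \<delta> (insert f (canonical_map X \<delta> ` A)) \<le> f A"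
  using A by (intro tight_span_div_leI canonical_selection_le[OF f A]) (auto simp: Fpow_def)

text \<open>
  The upper bound is the preceding estimate for a point \<open>f\<close> in the image of \<open>A\<close>. The lower bound
  comes from the family of singletons of \<open>A\<close>: its union is \<open>A\<close>, and its infima vanish because the
  image of \<open>x\<close> is \<open>0\<close> at \<open>{x}\<close>.
\<close>

lemma tight_span_div_canonical:
  assumes A: "A \<in> Fpow X"
  shows "tight_span_div X \<delta> (canonical_map X \<delta> ` A) = \<delta> A"
proof (cases "A = {}")
  case True
  then show ?thesis by (simp add: tight_span_div_def empty_eq_0)
next
  case False
  let ?k = "canonical_map X \<delta>"
  let ?F = "?k ` A"
  let ?g = "\<lambda>\<A>. \<delta> (\<Union>\<A>) - (\<Sum>B\<in>\<A>. INF f\<in>?F. f B)"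
  from False obtain a where a: "a \<in> A" by blast
  have AX: "A \<subseteq> X" "finite A" using A by (auto simp: Fpow_def)
  have F: "finite ?F" "?F \<noteq> {}" "?F \<subseteq> P_fun X \<delta>"
    using AX False canonical_map_P_fun by auto
  have ka: "?k a \<in> tight_span X \<delta>" "?k a A = \<delta> A" "insert (?k a) ?F = ?F"
    using a A AX canonical_map_tight_span by (auto simp: canonical_map_def insert_absorb)
  show ?thesis
  proof (rule order_antisym)
    show "tight_span_div X \<delta> ?F \<le> \<delta> A"
      using tight_span_div_canonical_le[OF ka(1) A] ka by simp
  next
    have bdd: "bdd_above (?g ` Fpow (Fpow X))"
    proof (rule bdd_aboveI2)
      show "?g \<A> \<le> \<delta> A" if "\<A> \<in> Fpow (Fpow X)" for \<A>
        using F that canonical_selection_le[OF ka(1) A, of \<A>] ka(2,3)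
        by (intro tight_span_div_term_le) (auto simp: Fpow_def)
    qed
    define \<S> where "\<S> = (\<lambda>x. {x}) ` A"
    have \<S>: "\<S> \<in> Fpow (Fpow X)" using AX by (auto simp: \<S>_def Fpow_def)
    have "(INF f\<in>?F. f B) \<le> 0" if B: "B \<in> \<S>" for B
    proof -
      obtain x where x: "x \<in> A" "B = {x}" using B by (auto simp: \<S>_def)
      have "B \<in> Fpow X" using B \<S> by (auto simp: Fpow_def)
      then have "bdd_below ((\<lambda>f. f B) ` ?F)"
        using F by (intro bdd_belowI[of _ 0]) (auto intro: P_fun_nonneg)
      then have "(INF f\<in>?F. f B) \<le> ?k x B" using x by (intro cINF_lower) auto
      also have "?k x B = 0" using x AX singleton_eq_0 by (auto simp: canonical_map_def Fpow_def)
      finally show ?thesis .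
    qed
    then have "(\<Sum>B\<in>\<S>. INF f\<in>?F. f B) \<le> 0" by (rule sum_nonpos)
    then have "\<delta> A \<le> ?g \<S>" by (simp add: \<S>_def)
    also have "\<dots> \<le> (SUP \<A>\<in>Fpow (Fpow X). ?g \<A>)" using \<S> bdd by (rule cSUP_upper)
    finally show "\<delta> A \<le> tight_span_div X \<delta> ?F" using F by (simp add: tight_span_div_def)
  qed
qed

lemma canonical_map_embedding:
  "diversity_embedding X \<delta> (tight_span X \<delta>) (tight_span_div X \<delta>) (canonical_map X \<delta>)"
  unfolding diversity_embedding_def
proof (intro conjI ballI)
  show "canonical_map X \<delta> \<in> X \<rightarrow> tight_span X \<delta>" using canonical_map_tight_span by blast
  show "inj_on (canonical_map X \<delta>) X"
  proof (rule inj_onI)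
    fix x y assume xy: "x \<in> X" "y \<in> X" "canonical_map X \<delta> x = canonical_map X \<delta> y"
    then have "\<delta> {x, y} = \<delta> {y, y}"
      by (metis (no_types, lifting) Fpow_def canonical_map_def empty_subsetI finite.emptyI
          finite_insert insert_subset mem_Collect_eq restrict_apply')
    then have "\<delta> {x, y} = 0" using singleton_eq_0 xy by simp
    then have "card {x, y} \<le> 1" using eq_0_iff[of "{x, y}"] xy by (simp add: Fpow_def)
    then show "x = y" by (cases "x = y") auto
  qed
  show "\<delta> A = tight_span_div X \<delta> (canonical_map X \<delta> ` A)" if "A \<in> Fpow X" for A
    using tight_span_div_canonical[OF that] by simp
qed

section \<open>Hyperconvexity and the tight span\<close>

lemma hyperconvex_imp_canonical_isomorphism:
  assumes hyp: "hyperconvex_diversity X \<delta>"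
  shows "diversity_isomorphism X \<delta> (tight_span X \<delta>) (tight_span_div X \<delta>) (canonical_map X \<delta>)"
  unfolding diversity_isomorphism_def
proof (intro conjI canonical_map_embedding order_antisym)
  show "canonical_map X \<delta> ` X \<subseteq> tight_span X \<delta>" using canonical_map_tight_span by blast
  show "tight_span X \<delta> \<subseteq> canonical_map X \<delta> ` X"
  proof
    fix f assume f: "f \<in> tight_span X \<delta>"
    have "\<forall>\<A>\<in>Fpow (Fpow X). \<delta> (\<Union>\<A>) \<le> (\<Sum>A\<in>\<A>. f A)"
      using P_funD(3)[OF tight_spanD(1)[OF f]] by (auto simp: Fpow_def)
    with hyp obtain z where z: "z \<in> X" "\<forall>A\<in>Fpow X. \<delta> ({z} \<union> A) \<le> f A"
      unfolding hyperconvex_diversity_def by blast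
    have "canonical_map X \<delta> z = f"
      by (rule tight_spanD(2)[OF f canonical_map_P_fun[OF z(1)]])
        (use z in \<open>simp add: canonical_map_def\<close>)
    then show "f \<in> canonical_map X \<delta> ` X" using z by blast
  qed
qed

text \<open>
  Let \<open>h\<close> be minimal below \<open>r\<close> over the tight span, let \<open>\<kappa>\<close> be the canonical map, and let \<open>g\<close> be
  minimal below \<open>A \<mapsto> h (\<kappa> ` A)\<close> over \<open>X\<close>. The claim is \<open>\<delta>\<^sub>T ({g} \<union> F) \<le> h F\<close>. For a selection, let
  \<open>U\<close> be the union of those sets \<open>B\<close> for which a function \<open>s B \<in> F\<close> is selected. Since \<open>g\<close> is
  admissible, the sets for which \<open>g\<close> is selected can be traded against \<open>g U\<close>. Finally
  \<open>g U \<le> h (\<kappa> ` U)\<close>, and gluing each \<open>\<kappa> ` B\<close> to \<open>F\<close> through \<open>s B\<close> bounds this by \<open>h F\<close> plus the sum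
  of the \<open>\<delta>\<^sub>T ({s B} \<union> \<kappa> ` B)\<close>, each of which is at most \<open>s B B\<close>.

  That the tight span is a diversity is a hypothesis here, because the gluing argument is applied
  inside it; for a tight span isomorphic to a diversity it holds by transport of structure.
\<close>

lemma tight_span_hyperconvex:
  assumes T: "diversity (tight_span X \<delta>) (tight_span_div X \<delta>)"
  shows "hyperconvex_diversity (tight_span X \<delta>) (tight_span_div X \<delta>)"
  unfolding hyperconvex_diversity_def
proof (intro allI impI)
  let ?T = "tight_span X \<delta>" and ?\<delta>T = "tight_span_div X \<delta>" and ?k = "canonical_map X \<delta>"
  interpret T: diversity ?T ?\<delta>T by (rule T)
  fix r assume r: "\<forall>\<F>\<in>Fpow (Fpow ?T). ?\<delta>T (\<Union>\<F>) \<le> (\<Sum>F\<in>\<F>. r F)"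
  obtain h where h: "h \<in> tight_span ?T ?\<delta>T" "\<forall>F\<in>Fpow ?T. h F \<le> r F"
    using T.tight_span_below[OF r] by blast
  note hP = tight_spanD(1)[OF h(1)]
  have kT: "?k ` A \<in> Fpow ?T" if "A \<in> Fpow X" for A
    using that canonical_map_tight_span by (auto simp: Fpow_def)
  have inj: "inj_on ?k X" using canonical_map_embedding by (simp add: diversity_embedding_def)
  have "\<forall>\<A>\<in>Fpow (Fpow X). \<delta> (\<Union>\<A>) \<le> (\<Sum>A\<in>\<A>. h (?k ` A))"
  proof
    fix \<A> assume "\<A> \<in> Fpow (Fpow X)"
    then have \<A>: "finite \<A>" "\<A> \<subseteq> Fpow X" by (auto simp: Fpow_def)
    then have "\<Union>\<A> \<in> Fpow X" by (auto simp: Fpow_def)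
    then have "\<delta> (\<Union>\<A>) = ?\<delta>T (\<Union>((`) ?k ` \<A>))"
      by (metis tight_span_div_canonical image_Union)
    also have "\<dots> \<le> (\<Sum>F\<in>(`) ?k ` \<A>. h F)"
      using \<A> kT by (intro P_funD(3)[OF hP]) auto
    also have "\<dots> = (\<Sum>A\<in>\<A>. h (?k ` A))"
    proof (subst sum.reindex)
      show "inj_on ((`) ?k) \<A>"
        using \<A>(2) inj by (intro inj_onI) (auto simp: Fpow_def inj_on_image_eq_iff subset_eq)
    qed simp
    finally show "\<delta> (\<Union>\<A>) \<le> (\<Sum>A\<in>\<A>. h (?k ` A))" .
  qed
  from tight_span_below[OF this] obtain g
    where g: "g \<in> ?T" "\<forall>A\<in>Fpow X. g A \<le> h (?k ` A)" by blast
  note gP = tight_spanD(1)[OF g(1)]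
  have "?\<delta>T ({g} \<union> F) \<le> r F" if F: "F \<in> Fpow ?T" for F
  proof (rule order_trans[of _ "h F"])
    show "h F \<le> r F" using h(2) F by blast
    show "?\<delta>T ({g} \<union> F) \<le> h F"
    proof (rule tight_span_div_leI)
      show "finite ({g} \<union> F)" using F by (auto simp: Fpow_def)
      show "{g} \<union> F \<noteq> {}" by simp
      fix \<A> s assume \<A>: "finite \<A>" "\<A> \<subseteq> Fpow X" and s: "s ` \<A> \<subseteq> {g} \<union> F"
      define \<A>1 where "\<A>1 = {B\<in>\<A>. s B = g}"
      define \<A>2 where "\<A>2 = \<A> - \<A>1"
      have sub: "finite \<A>1" "finite \<A>2" "\<A>1 \<subseteq> Fpow X" "\<A>2 \<subseteq> Fpow X" "\<A> = \<A>1 \<union> \<A>2"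
          "\<A>1 \<inter> \<A>2 = {}"
        using \<A> by (auto simp: \<A>1_def \<A>2_def)
      have sF: "s B \<in> F" "s B \<in> ?T" if "B \<in> \<A>2" for B
        using that s F by (auto simp: \<A>1_def \<A>2_def Fpow_def)
      have U: "\<Union>\<A>2 \<in> Fpow X" using sub by (auto simp: Fpow_def)
      have "\<Union>\<A> = \<Union>\<A>2 \<union> \<Union>\<A>1" using sub by blast
      then have "\<delta> (\<Union>\<A>) \<le> g (\<Union>\<A>2) + (\<Sum>B\<in>\<A>1. g B)"
        using sub U P_fun_Un[OF gP] by simp
      also have "(\<Sum>B\<in>\<A>1. g B) = (\<Sum>B\<in>\<A>1. s B B)"
        by (intro sum.cong) (auto simp: \<A>1_def)
      also have "g (\<Union>\<A>2) \<le> h (?k ` \<Union>\<A>2)" using g(2) U by blast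
      also have "h (?k ` \<Union>\<A>2) \<le> h F + (\<Sum>B\<in>\<A>2. ?\<delta>T (insert (s B) (?k ` B)))"
      proof (rule T.tight_span_glue[OF h(1) sub(2) F])
        show "insert (s B) (?k ` B) \<in> Fpow ?T" if "B \<in> \<A>2" for B
          using sF[OF that] kT[of B] that sub by (auto simp: Fpow_def)
        show "insert (s B) (?k ` B) \<inter> F \<noteq> {}" if "B \<in> \<A>2" for B
          using sF[OF that] by blast
      qed blast
      also have "(\<Sum>B\<in>\<A>2. ?\<delta>T (insert (s B) (?k ` B))) \<le> (\<Sum>B\<in>\<A>2. s B B)"
        using sF sub by (intro sum_mono tight_span_div_canonical_le) auto
      also have "h F + (\<Sum>B\<in>\<A>2. s B B) + (\<Sum>B\<in>\<A>1. s B B) = h F + (\<Sum>B\<in>\<A>. s B B)"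
        using sub by (simp add: sum.union_disjoint)
      finally show "\<delta> (\<Union>\<A>) \<le> h F + (\<Sum>B\<in>\<A>. s B B)" by simp
    qed
  qed
  then show "\<exists>z\<in>?T. \<forall>F\<in>Fpow ?T. ?\<delta>T ({z} \<union> F) \<le> r F" using g(1) by blast
qed

lemma isomorphic_diversity:
  assumes iso: "diversity_isomorphism X \<delta> Y \<epsilon> \<phi>"
  shows "diversity Y \<epsilon>"
proof -
  have bij: "inj_on \<phi> X" "\<phi> ` X = Y" and eq: "\<And>A. A \<in> Fpow X \<Longrightarrow> \<epsilon> (\<phi> ` A) = \<delta> A"
    using iso by (auto simp: diversity_isomorphism_def diversity_embedding_def)
  have ex: "\<exists>A\<in>Fpow X. B = \<phi> ` A \<and> card B = card A" if "B \<in> Fpow Y" for B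
  proof -
    have "finite B" "B \<subseteq> \<phi> ` X" using that bij by (auto simp: Fpow_def)
    then obtain A where "A \<subseteq> X" "finite A" "B = \<phi> ` A" by (meson finite_subset_image)
    then show ?thesis using bij card_image[of \<phi> A] by (auto simp: Fpow_def inj_on_subset)
  qed
  have Un: "A \<union> B \<in> Fpow X" if "A \<in> Fpow X" "B \<in> Fpow X" for A B
    using that by (auto simp: Fpow_def)
  show ?thesis
  proof
    show "0 \<le> \<epsilon> B" if "B \<in> Fpow Y" for B using ex[OF that] eq nonneg by auto
    show "\<epsilon> B = 0 \<longleftrightarrow> card B \<le> 1" if "B \<in> Fpow Y" for B
      using ex[OF that] eq eq_0_iff by auto
    fix A B C assume "A \<in> Fpow Y" "B \<in> Fpow Y" "C \<in> Fpow Y" "B \<noteq> {}"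
    then obtain A' B' C' where *: "A' \<in> Fpow X" "B' \<in> Fpow X" "C' \<in> Fpow X" "B' \<noteq> {}"
      "A = \<phi> ` A'" "B = \<phi> ` B'" "C = \<phi> ` C'" using ex by (metis image_is_empty)
    then show "\<epsilon> (A \<union> C) \<le> \<epsilon> (A \<union> B) + \<epsilon> (B \<union> C)"
      using triangle[of A' B' C'] by (simp add: image_Un[symmetric] eq Un)
  qed
qed

end

lemma isomorphic_hyperconvex:
  assumes iso: "diversity_isomorphism X \<delta> Y \<epsilon> \<phi>" and hyp: "hyperconvex_diversity Y \<epsilon>"
  shows "hyperconvex_diversity X \<delta>"
  unfolding hyperconvex_diversity_def
proof (intro allI impI)
  have bij: "inj_on \<phi> X" "\<phi> ` X = Y" and eq: "\<And>A. A \<in> Fpow X \<Longrightarrow> \<epsilon> (\<phi> ` A) = \<delta> A"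
    using iso by (auto simp: diversity_isomorphism_def diversity_embedding_def)
  let ?i = "inv_into X \<phi>"
  fix r assume r: "\<forall>\<A>\<in>Fpow (Fpow X). \<delta> (\<Union>\<A>) \<le> (\<Sum>A\<in>\<A>. r A)"
  have i: "?i ` B \<in> Fpow X" "\<phi> ` ?i ` B = B" if "B \<in> Fpow Y" for B
    using that bij by (auto simp: Fpow_def inv_into_into image_inv_into_cancel)
  have "\<forall>\<B>\<in>Fpow (Fpow Y). \<epsilon> (\<Union>\<B>) \<le> (\<Sum>B\<in>\<B>. r (?i ` B))"
  proof
    fix \<B> assume "\<B> \<in> Fpow (Fpow Y)"
    then have \<B>: "finite \<B>" "\<B> \<subseteq> Fpow Y" by (auto simp: Fpow_def)
    then have U: "\<Union>\<B> \<in> Fpow Y" by (auto simp: Fpow_def)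
    have "\<epsilon> (\<Union>\<B>) = \<delta> (?i ` \<Union>\<B>)" using eq[OF i(1)[OF U]] i(2)[OF U] by simp
    also have "\<dots> = \<delta> (\<Union>((`) ?i ` \<B>))" by (simp add: image_Union)
    also have "\<dots> \<le> (\<Sum>A\<in>(`) ?i ` \<B>. r A)"
    proof -
      have "(`) ?i ` \<B> \<in> Fpow (Fpow X)" using \<B> i(1) unfolding Fpow_def[of "Fpow X"] by auto
      with r show ?thesis by blast
    qed
    also have "\<dots> = (\<Sum>B\<in>\<B>. r (?i ` B))"
    proof (subst sum.reindex)
      show "inj_on ((`) ?i) \<B>" using \<B> i(2) by (metis inj_onI subsetD)
    qed simp
    finally show "\<epsilon> (\<Union>\<B>) \<le> (\<Sum>B\<in>\<B>. r (?i ` B))" .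
  qed
  with hyp obtain z where z: "z \<in> Y" "\<forall>B\<in>Fpow Y. \<epsilon> ({z} \<union> B) \<le> r (?i ` B)"
    unfolding hyperconvex_diversity_def by blast
  from z(1) bij obtain x where x: "x \<in> X" "z = \<phi> x" by blast
  have "\<delta> ({x} \<union> A) \<le> r A" if "A \<in> Fpow X" for A
  proof -
    have img: "\<phi> ` A \<in> Fpow Y" using that bij by (auto simp: Fpow_def)
    have "\<delta> ({x} \<union> A) = \<epsilon> ({z} \<union> \<phi> ` A)"
      using eq[of "{x} \<union> A"] that x by (simp add: Fpow_def)
    also have "\<dots> \<le> r (?i ` \<phi> ` A)" using z(2) img by blast
    also have "?i ` \<phi> ` A = A"
      using that bij by (simp add: Fpow_def inv_into_image_cancel)
    finally show ?thesis .
  qed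
  then show "\<exists>z\<in>X. \<forall>A\<in>Fpow X. \<delta> ({z} \<union> A) \<le> r A" using x by blast
qed

section \<open>Hyperconvexity and injectivity\<close>

context diversity
begin

text \<open>
  Hyperconvexity for an arbitrary family of requirements \<open>\<delta> (insert z (A i)) \<le> \<rho> i\<close>, in which a set
  may occur several times or not at all. The real-valued function needed by the definition charges
  to a set \<open>B\<close> the cheapest way of covering \<open>B\<close> by some \<open>A i\<close> and a correction set \<open>C\<close> that is
  empty or meets \<open>A i\<close>. The correction sets keep the value finite at sets covered by no \<open>A i\<close>, and
  they can be removed by gluing.
\<close>

lemma hyperconvex_family:
  fixes A :: "'i \<Rightarrow> 'a set"
  assumes hyp: "hyperconvex_diversity X \<delta>"
    and A: "\<And>i. i \<in> S \<Longrightarrow> A i \<in> Fpow X"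
    and \<rho>: "\<And>I. \<lbrakk>finite I; I \<subseteq> S\<rbrakk> \<Longrightarrow> \<delta> (\<Union>i\<in>I. A i) \<le> (\<Sum>i\<in>I. \<rho> i)"
  shows "\<exists>z\<in>X. \<forall>i\<in>S. \<delta> (insert z (A i)) \<le> \<rho> i"
proof -
  have \<rho>0: "0 \<le> \<rho> i" if "i \<in> S" for i
    using \<rho>[of "{i}"] nonneg[OF A[OF that]] that by simp
  show ?thesis
  proof (cases "\<exists>i\<in>S. A i \<noteq> {}")
    case False
    \<comment> \<open>only \<open>\<delta> {z} \<le> \<rho> i\<close> is required, so any point will do\<close>
    have "\<exists>z. z \<in> X"
    proof (rule ccontr)
      assume "\<not> ?thesis"
      then have "\<Union>\<A> = {}" if "\<A> \<in> Fpow (Fpow X)" for \<A>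
        using that by (fastforce simp: Fpow_def)
      then have "\<forall>\<A>\<in>Fpow (Fpow X). \<delta> (\<Union>\<A>) \<le> (\<Sum>A\<in>\<A>. 0)"
        by (metis empty_eq_0 order_refl sum.neutral_const)
      then have "\<exists>z\<in>X. \<forall>Y\<in>Fpow X. \<delta> ({z} \<union> Y) \<le> 0"
        using hyp unfolding hyperconvex_diversity_def by (elim allE[of _ "\<lambda>_. 0"]) blast
      then show False using \<open>\<not> (\<exists>z. z \<in> X)\<close> by blast
    qed
    then obtain z where "z \<in> X" ..
    then show ?thesis using False \<rho>0 singleton_eq_0 by (intro bexI[of _ z]) auto
  next
    case True
    then obtain i0 x0 where i0: "i0 \<in> S" "x0 \<in> A i0" by blast
    then have x0: "x0 \<in> X" using A by (auto simp: Fpow_def)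
    define W where "W = (\<lambda>B. {(i, C). i \<in> S \<and> C \<in> Fpow X \<and> B \<subseteq> A i \<union> C \<and> (C = {} \<or> C \<inter> A i \<noteq> {})})"
    define r where "r B = (INF (i, C)\<in>W B. \<rho> i + \<delta> C)" for B
    have bdd: "bdd_below ((\<lambda>(i, C). \<rho> i + \<delta> C) ` W B)" for B
      using \<rho>0 nonneg by (intro bdd_belowI[of _ 0]) (auto simp: W_def intro: add_nonneg_nonneg)
    have ne: "W B \<noteq> {}" if "B \<in> Fpow X" for B
    proof -
      have "(i0, insert x0 B) \<in> W B" using that i0 x0 by (auto simp: W_def Fpow_def)
      then show ?thesis by blast
    qed
    have "\<forall>\<B>\<in>Fpow (Fpow X). \<delta> (\<Union>\<B>) \<le> (\<Sum>B\<in>\<B>. r B)"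
    proof
      fix \<B> assume "\<B> \<in> Fpow (Fpow X)"
      then have \<B>: "finite \<B>" "\<B> \<subseteq> Fpow X" by (auto simp: Fpow_def)
      show "\<delta> (\<Union>\<B>) \<le> (\<Sum>B\<in>\<B>. r B)"
      proof (rule field_le_epsilon)
        fix e :: real assume "e > 0"
        define d where "d = e / (real (card \<B>) + 1)"
        have "d > 0" using \<open>e > 0\<close> by (simp add: d_def add_nonneg_pos)
        have "\<exists>i C. (i, C) \<in> W B \<and> \<rho> i + \<delta> C < r B + d" if "B \<in> \<B>" for B
        proof -
          have "r B < r B + d" using \<open>d > 0\<close> by simp
          then have "\<exists>p\<in>W B. (case p of (i, C) \<Rightarrow> \<rho> i + \<delta> C) < r B + d"
            using cINF_less_iff[OF ne bdd, of B "r B + d"] that \<B>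
            unfolding r_def[symmetric] by blast
          then show ?thesis by auto
        qed
        then obtain i C where iC: "\<And>B. B \<in> \<B> \<Longrightarrow> (i B, C B) \<in> W B"
          "\<And>B. B \<in> \<B> \<Longrightarrow> \<rho> (i B) + \<delta> (C B) < r B + d" by metis
        let ?F = "\<Union>j\<in>i ` \<B>. A j"
        have iS: "i ` \<B> \<subseteq> S" using iC by (auto simp: W_def)
        then have F: "?F \<in> Fpow X" using A \<B> by (fastforce simp: Fpow_def)
        have C: "C B \<in> Fpow X" "B \<subseteq> A (i B) \<union> C B" "C B = {} \<or> C B \<inter> A (i B) \<noteq> {}" if "B \<in> \<B>" for B
          using iC(1)[OF that] by (auto simp: W_def)
        have "\<delta> (\<Union>\<B>) \<le> \<delta> (?F \<union> (\<Union>B\<in>\<B>. C B))"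
        proof (rule mono)
          show "\<Union>\<B> \<subseteq> ?F \<union> (\<Union>B\<in>\<B>. C B)" using C(2) by blast
          show "?F \<union> (\<Union>B\<in>\<B>. C B) \<in> Fpow X"
            using C(1) F \<B>(1) by (auto simp: Fpow_def)
        qed
        also have "\<dots> \<le> \<delta> ?F + (\<Sum>B\<in>\<B>. \<delta> (C B))"
        proof (rule glue[OF \<B>(1) F])
          show "C B \<in> Fpow X" if "B \<in> \<B>" for B using C(1)[OF that] .
          show "C B = {} \<or> C B \<inter> ?F \<noteq> {}" if "B \<in> \<B>" for B
          proof -
            have "A (i B) \<subseteq> ?F" using that by blast
            then show ?thesis using C(3)[OF that] by blast
          qed
        qed
        also have "\<delta> ?F \<le> (\<Sum>j\<in>i ` \<B>. \<rho> j)" using iS \<B> by (intro \<rho>) auto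
        also have "(\<Sum>j\<in>i ` \<B>. \<rho> j) \<le> (\<Sum>B\<in>\<B>. \<rho> (i B))"
          using sum_image_le[OF \<B>(1), of \<rho> i] \<rho>0 iS unfolding o_def by blast
        also have "(\<Sum>B\<in>\<B>. \<rho> (i B)) + (\<Sum>B\<in>\<B>. \<delta> (C B)) \<le> (\<Sum>B\<in>\<B>. r B + d)"
          unfolding sum.distrib[symmetric] using iC(2) by (intro sum_mono) force
        also have "\<dots> = (\<Sum>B\<in>\<B>. r B) + card \<B> * d" by (simp add: sum.distrib)
        also have "card \<B> * d \<le> e" using \<open>e > 0\<close> by (simp add: d_def field_simps)
        finally show "\<delta> (\<Union>\<B>) \<le> (\<Sum>B\<in>\<B>. r B) + e" by simp
      qed
    qed
    with hyp obtain z where z: "z \<in> X" "\<forall>B\<in>Fpow X. \<delta> ({z} \<union> B) \<le> r B"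
      unfolding hyperconvex_diversity_def by blast
    have "r (A i) \<le> \<rho> i" if "i \<in> S" for i
    proof -
      have "(i, {}) \<in> W (A i)" using that by (auto simp: W_def Fpow_def)
      from cINF_lower[OF bdd this] show ?thesis by (simp add: r_def empty_eq_0)
    qed
    then have "\<delta> (insert z (A i)) \<le> \<rho> i" if "i \<in> S" for i
      using that z(2) A[OF that] by force
    then show ?thesis using z(1) by blast
  qed
qed

text \<open>
  Partial extensions are represented by their graphs: sets \<open>G\<close> of pairs such that every finite
  \<open>H \<subseteq> G\<close> satisfies \<open>\<delta> (snd ` H) \<le> \<delta>2 (fst ` H)\<close>. This condition has finite character, which
  yields the upper bounds for Zorn's lemma, and it forces \<open>G\<close> to be single-valued because
  singletons have diversity \<open>0\<close>. A point \<open>z\<close> may be added as an image of \<open>y\<close> exactly when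
  \<open>\<delta> (insert z (snd ` H)) \<le> \<delta>2 (insert y (fst ` H))\<close> for all finite \<open>H \<subseteq> G\<close>. These requirements
  are admissible by nonexpansiveness of \<open>G\<close> and the star inequality at \<open>y\<close>.
\<close>

lemma hyperconvex_imp_extension:
  assumes hyp: "hyperconvex_diversity X \<delta>"
    and Y2: "diversity Y2 \<delta>2"
    and \<pi>: "diversity_embedding Y1 \<delta>1 Y2 \<delta>2 \<pi>"
    and \<phi>: "nonexpansive Y1 \<delta>1 X \<delta> \<phi>"
  shows "\<exists>\<psi>. nonexpansive Y2 \<delta>2 X \<delta> \<psi> \<and> (\<forall>y\<in>Y1. \<phi> y = \<psi> (\<pi> y))"
proof -
  interpret Y2: diversity Y2 \<delta>2 by (rule Y2)
  define G0 where "G0 = (\<lambda>y. (\<pi> y, \<phi> y)) ` Y1"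
  define \<G> where "\<G> = {G. G0 \<subseteq> G \<and> G \<subseteq> Y2 \<times> X \<and>
    (\<forall>H. finite H \<longrightarrow> H \<subseteq> G \<longrightarrow> \<delta> (snd ` H) \<le> \<delta>2 (fst ` H))}"
  have G0: "G0 \<in> \<G>"
  proof -
    have "\<delta> (snd ` H) \<le> \<delta>2 (fst ` H)" if H: "finite H" "H \<subseteq> G0" for H
    proof -
      from H obtain B where B: "B \<subseteq> Y1" "finite B" "H = (\<lambda>y. (\<pi> y, \<phi> y)) ` B"
        unfolding G0_def by (meson finite_subset_image)
      then have BF: "B \<in> Fpow Y1" by (simp add: Fpow_def)
      have "snd ` H = \<phi> ` B" "fst ` H = \<pi> ` B" using B by (auto simp: image_image)
      then show ?thesis using BF \<pi> \<phi> by (simp add: diversity_embedding_def nonexpansive_def)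
    qed
    moreover have "G0 \<subseteq> Y2 \<times> X"
      using \<pi> \<phi> by (auto simp: G0_def diversity_embedding_def nonexpansive_def)
    ultimately show ?thesis by (simp add: \<G>_def)
  qed
  have "\<exists>M\<in>\<G>. \<forall>G\<in>\<G>. M \<subseteq> G \<longrightarrow> G = M"
  proof (rule subset_Zorn_nonempty)
    show "\<G> \<noteq> {}" using G0 by blast
    fix \<C> assume \<C>: "\<C> \<noteq> {}" "subset.chain \<G> \<C>"
    have sub: "\<C> \<subseteq> \<G>" using \<C>(2) by (simp add: subset.chain_def)
    have "\<delta> (snd ` H) \<le> \<delta>2 (fst ` H)" if H: "finite H" "H \<subseteq> \<Union>\<C>" for H
    proof -
      obtain G where "G \<in> \<C>" "H \<subseteq> G"
        using finite_subset_Union_chain[OF H \<C>] by blast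
      then show ?thesis using sub H by (auto simp: \<G>_def)
    qed
    moreover have "G0 \<subseteq> \<Union>\<C>" using sub \<C>(1) by (fastforce simp: \<G>_def)
    moreover have "\<Union>\<C> \<subseteq> Y2 \<times> X" using sub by (auto simp: \<G>_def)
    ultimately show "\<Union>\<C> \<in> \<G>" by (simp add: \<G>_def)
  qed
  then obtain M where M: "M \<in> \<G>" "\<And>G. \<lbrakk>G \<in> \<G>; M \<subseteq> G\<rbrakk> \<Longrightarrow> G = M" by blast
  have MYX: "M \<subseteq> Y2 \<times> X" and G0M: "G0 \<subseteq> M"
    and MH: "\<And>H. \<lbrakk>finite H; H \<subseteq> M\<rbrakk> \<Longrightarrow> \<delta> (snd ` H) \<le> \<delta>2 (fst ` H)"
    using M(1) by (auto simp: \<G>_def)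
  have total: "\<exists>z. (y, z) \<in> M" if y: "y \<in> Y2" for y
  proof -
    have "\<exists>z\<in>X. \<forall>H\<in>Fpow M. \<delta> (insert z (snd ` H)) \<le> \<delta>2 (insert y (fst ` H))"
    proof (rule hyperconvex_family[OF hyp])
      show "snd ` H \<in> Fpow X" if "H \<in> Fpow M" for H
        using that MYX by (force simp: Fpow_def)
      fix I assume I: "finite I" "I \<subseteq> Fpow M"
      have fin: "finite (\<Union>I)" "\<Union>I \<subseteq> M" using I by (auto simp: Fpow_def)
      have fst: "fst ` H \<in> Fpow Y2" if "H \<in> I" for H
        using that I MYX by (force simp: Fpow_def)
      have "\<delta> (\<Union>H\<in>I. snd ` H) = \<delta> (snd ` \<Union>I)" by (simp add: image_Union)
      also have "\<dots> \<le> \<delta>2 (fst ` \<Union>I)" by (rule MH[OF fin])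
      also have "\<dots> = \<delta>2 (\<Union>H\<in>I. fst ` H)" by (simp add: image_Union)
      also have "\<dots> \<le> (\<Sum>H\<in>I. \<delta>2 (insert y (fst ` H)))"
        by (rule Y2.star[OF I(1) y fst])
      finally show "\<delta> (\<Union>H\<in>I. snd ` H) \<le> (\<Sum>H\<in>I. \<delta>2 (insert y (fst ` H)))" .
    qed
    then obtain z where z: "z \<in> X" "\<And>H. H \<in> Fpow M \<Longrightarrow> \<delta> (insert z (snd ` H)) \<le> \<delta>2 (insert y (fst ` H))"
      by blast
    have "\<delta> (snd ` H) \<le> \<delta>2 (fst ` H)" if H: "finite H" "H \<subseteq> insert (y, z) M" for H
    proof (cases "(y, z) \<in> H")
      case True
      then have "H = insert (y, z) (H - {(y, z)})" by blast
      moreover have "H - {(y, z)} \<in> Fpow M" using H by (auto simp: Fpow_def)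
      ultimately show ?thesis using z(2) by (metis fst_conv image_insert snd_conv)
    next
      case False
      then show ?thesis using H MH by blast
    qed
    then have "insert (y, z) M \<in> \<G>"
      using MYX G0M y z(1) by (auto simp: \<G>_def)
    then have "insert (y, z) M = M" using M(2) by blast
    then show ?thesis by blast
  qed
  have unique: "x = x'" if "(y, x) \<in> M" "(y, x') \<in> M" for y x x'
  proof -
    have X: "{x, x'} \<in> Fpow X" "y \<in> Y2" using that MYX by (auto simp: Fpow_def)
    have "\<delta> {x, x'} \<le> \<delta>2 {y}" using MH[of "{(y, x), (y, x')}"] that by simp
    then have "\<delta> {x, x'} = 0"
      using Y2.singleton_eq_0[OF X(2)] nonneg[OF X(1)] by simp
    then have "card {x, x'} \<le> 1" using eq_0_iff[OF X(1)] by simp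
    then show ?thesis by (cases "x = x'") auto
  qed
  from total obtain \<psi> where \<psi>: "\<And>y. y \<in> Y2 \<Longrightarrow> (y, \<psi> y) \<in> M" by metis
  have "nonexpansive Y2 \<delta>2 X \<delta> \<psi>"
    unfolding nonexpansive_def
  proof (intro conjI ballI)
    show "\<psi> \<in> Y2 \<rightarrow> X" using \<psi> MYX by blast
    fix B assume "B \<in> Fpow Y2"
    then have "finite B" "B \<subseteq> Y2" by (auto simp: Fpow_def)
    then show "\<delta> (\<psi> ` B) \<le> \<delta>2 B"
      using MH[of "(\<lambda>y. (y, \<psi> y)) ` B"] \<psi> by (auto simp: image_image)
  qed
  moreover have "\<phi> y = \<psi> (\<pi> y)" if "y \<in> Y1" for y
  proof -
    have "(\<pi> y, \<phi> y) \<in> M" using that G0M by (auto simp: G0_def)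
    moreover from this have "(\<pi> y, \<psi> (\<pi> y)) \<in> M" using \<psi> MYX by blast
    ultimately show ?thesis by (rule unique)
  qed
  ultimately show ?thesis by blast
qed

text \<open>
  Adjoining the virtual point described by \<open>f\<close>, with \<open>None\<close> as the new point. Each position of
  \<open>None\<close> among the three sets of the triangle inequality is one of the monotonicity, subadditivity
  and gluing properties of the tight span. The hypothesis \<open>pos\<close> says that the new point coincides
  with no old one; monotonicity of \<open>f\<close> then makes \<open>f\<close> nonzero at all nonempty sets.
\<close>

lemma one_point_extension:
  assumes f: "f \<in> tight_span X \<delta>" and pos: "\<And>x. x \<in> X \<Longrightarrow> f {x} \<noteq> 0"
  shows "diversity (insert None (Some ` X))
    (\<lambda>A. if None \<in> A then f (Some -` A) else \<delta> (Some -` A))" (is "diversity ?X ?d")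
proof -
  note fP = tight_spanD(1)[OF f]
  have V: "Some -` A \<in> Fpow X" if "A \<in> Fpow ?X" for A
    using that by (auto simp: Fpow_def intro: finite_vimageI)
  have card0: "card A = (if None \<in> A then 1 else 0) + card (Some -` A)"
    if "finite A" for A :: "'a option set"
  proof -
    have "A = (if None \<in> A then {None} else {}) \<union> Some ` (Some -` A)"
    proof (rule set_eqI)
      show "y \<in> A \<longleftrightarrow> y \<in> (if None \<in> A then {None} else {}) \<union> Some ` (Some -` A)" for y
        by (cases y) auto
    qed
    moreover have "card ((if None \<in> A then {None} else {}) \<union> Some ` (Some -` A)) =
      (if None \<in> A then 1 else 0) + card (Some -` A)"
      using that by (subst card_Un_disjoint) 
        (auto simp: card_image simp del: image_vimage_eq intro!: finite_imageI finite_vimageI)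
    ultimately show ?thesis by metis
  qed
  show ?thesis
  proof
    fix A assume A: "A \<in> Fpow ?X"
    show "0 \<le> ?d A" using V[OF A] nonneg P_fun_nonneg[OF fP] by simp
    have finA: "finite A" using A by (simp add: Fpow_def)
    show "?d A = 0 \<longleftrightarrow> card A \<le> 1"
    proof (cases "None \<in> A")
      case False
      then show ?thesis using V[OF A] eq_0_iff card0[OF finA] by simp
    next
      case True
      have "f (Some -` A) = 0 \<longleftrightarrow> Some -` A = {}"
      proof
        assume 0: "f (Some -` A) = 0"
        show "Some -` A = {}"
        proof (rule ccontr)
          assume "Some -` A \<noteq> {}"
          then obtain x where x: "x \<in> Some -` A" by blast
          then have "x \<in> X" "{x} \<in> Fpow X" using V[OF A] by (auto simp: Fpow_def)
          moreover have "f {x} \<le> f (Some -` A)"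
            using x V[OF A] by (intro tight_span_mono[OF f]) auto
          ultimately show False using 0 pos P_fun_nonneg[OF fP] by (metis order_antisym)
        qed
      next
        show "f (Some -` A) = 0" if "Some -` A = {}" using that P_funD(2)[OF fP] by simp
      qed
      then show ?thesis
        using True card0[OF finA] V[OF A] by (auto simp: Fpow_def)
    qed
  next
    fix A B C assume ABC: "A \<in> Fpow ?X" "B \<in> Fpow ?X" "C \<in> Fpow ?X" "B \<noteq> {}"
    let ?A = "Some -` A" and ?B = "Some -` B" and ?C = "Some -` C"
    note V = V[OF ABC(1)] V[OF ABC(2)] V[OF ABC(3)]
    have U: "?A \<union> ?B \<in> Fpow X" "?B \<union> ?C \<in> Fpow X" "?A \<union> ?B \<union> ?C \<in> Fpow X" "?A \<union> ?C \<in> Fpow X"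
      using V by (auto simp: Fpow_def)
    have sub_\<delta>: "\<delta> (?A \<union> ?C) \<le> f (?A \<union> ?B) + f (?B \<union> ?C)"
    proof -
      have "\<delta> (?A \<union> ?C) \<le> \<delta> ((?A \<union> ?B) \<union> (?B \<union> ?C))"
        using U by (intro mono) (auto simp: Fpow_def)
      then show ?thesis using P_fun_Un2[OF fP U(1,2)] by simp
    qed
    have sub_f: "f (?A \<union> ?C) \<le> f (?A \<union> ?B) + f (?B \<union> ?C)"
    proof -
      have "f (?A \<union> ?C) \<le> f ((?A \<union> ?B) \<union> (?B \<union> ?C))"
        using U by (intro tight_span_mono[OF f]) (auto simp: Fpow_def)
      then show ?thesis using tight_span_Un_le[OF f U(1,2)] by simp
    qed
    have glueA: "f (?A \<union> ?C) \<le> f (?A \<union> ?B) + \<delta> (?B \<union> ?C)" if "?B \<noteq> {}"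
    proof -
      have "(?B \<union> ?C) \<inter> (?A \<union> ?B) \<noteq> {}" using that by blast
      then have "f (?A \<union> ?C) \<le> f (?A \<union> ?B) + (\<Sum>_\<in>{()}. \<delta> (?B \<union> ?C))"
        using U by (intro tight_span_glue[OF f]) auto
      then show ?thesis by simp
    qed
    have glueC: "f (?A \<union> ?C) \<le> \<delta> (?A \<union> ?B) + f (?B \<union> ?C)" if "?B \<noteq> {}"
    proof -
      have "(?A \<union> ?B) \<inter> (?B \<union> ?C) \<noteq> {}" using that by blast
      then have "f (?A \<union> ?C) \<le> f (?B \<union> ?C) + (\<Sum>_\<in>{()}. \<delta> (?A \<union> ?B))"
        using U by (intro tight_span_glue[OF f]) auto
      then show ?thesis by simp
    qed
    have Bne: "?B \<noteq> {}" if "None \<notin> B"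
    proof -
      obtain b where "b \<in> B" using ABC(4) by blast
      then show ?thesis using that by (cases b) auto
    qed
    show "?d (A \<union> C) \<le> ?d (A \<union> B) + ?d (B \<union> C)"
      using sub_\<delta> sub_f glueA glueC Bne triangle[OF V]
      by (cases "None \<in> B"; cases "None \<in> A"; cases "None \<in> C") (simp_all add: vimage_Un)
  qed
qed

text \<open>
  Either the minimal function below \<open>r\<close> already describes a point of \<open>X\<close>, or its virtual point can
  be adjoined and is sent to a suitable point by an extension of the identity. The test spaces live
  on \<open>'a option\<close>, which is why the type for testing injectivity has to contain a copy of it.
\<close>

lemma injective_imp_hyperconvex:
  fixes e :: "'a option \<Rightarrow> 'u"
  assumes inj: "injective_diversity TYPE('u) X \<delta>" and e: "inj e"
  shows "hyperconvex_diversity X \<delta>"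
  unfolding hyperconvex_diversity_def
proof (intro allI impI)
  fix r assume "\<forall>\<A>\<in>Fpow (Fpow X). \<delta> (\<Union>\<A>) \<le> (\<Sum>A\<in>\<A>. r A)"
  from tight_span_below[OF this] obtain f
    where f: "f \<in> tight_span X \<delta>" "\<And>A. A \<in> Fpow X \<Longrightarrow> f A \<le> r A" by blast
  have "\<exists>z\<in>X. \<forall>A\<in>Fpow X. \<delta> (insert z A) \<le> f A"
  proof (cases "\<exists>x\<in>X. f {x} = 0")
    case True
    then show ?thesis using P_fun_zero_le[OF tight_spanD(1)[OF f(1)]] by force
  next
    case False
    let ?X = "insert None (Some ` X)"
    let ?d = "\<lambda>A. if None \<in> A then f (Some -` A) else \<delta> (Some -` A)"
    have vimage: "Some -` Some ` A = A" for A :: "'a set" by (auto simp: vimage_def)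
    have vimage_None: "Some -` insert None (Some ` A) = A" for A :: "'a set"
      by (auto simp: vimage_def)
    have "diversity ?X ?d" using False by (intro one_point_extension[OF f(1)]) auto
    moreover have "diversity_embedding X \<delta> ?X ?d Some"
      by (auto simp: diversity_embedding_def vimage)
    moreover have "nonexpansive X \<delta> X \<delta> (\<lambda>x. x)" by (simp add: nonexpansive_def)
    moreover have "inj (e \<circ> Some)" using e by (simp add: inj_compose)
    ultimately obtain \<psi> where \<psi>: "nonexpansive ?X ?d X \<delta> \<psi>" "\<forall>x\<in>X. x = \<psi> (Some x)"
      using injective_diversity_extend[OF inj _ e diversity_axioms] by blast
    have "\<psi> None \<in> X" using \<psi>(1) by (auto simp: nonexpansive_def)
    moreover have "\<delta> (insert (\<psi> None) A) \<le> f A" if A: "A \<in> Fpow X" for A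
    proof -
      let ?A = "insert None (Some ` A)"
      have "?A \<in> Fpow ?X" using A by (auto simp: Fpow_def)
      then have "\<delta> (\<psi> ` ?A) \<le> ?d ?A" using \<psi>(1) unfolding nonexpansive_def by blast
      also have "?d ?A = f A" by (simp add: vimage_None)
      also have "\<psi> ` ?A = insert (\<psi> None) A"
        using \<psi>(2) A by (force simp: Fpow_def image_iff)
      finally show ?thesis .
    qed
    ultimately show ?thesis by blast
  qed
  then show "\<exists>z\<in>X. \<forall>A\<in>Fpow X. \<delta> ({z} \<union> A) \<le> r A"
    using f(2) by (auto intro: order_trans)
qed

end

theorem corollary3p9:
  fixes X :: "'a set" and \<delta> :: "'a set \<Rightarrow> real"
  assumes "diversity X \<delta>"
  shows "(hyperconvex_diversity X \<delta> \<longleftrightarrow>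
            injective_diversity TYPE('v + ('a set \<Rightarrow> real)) X \<delta>) \<and>
         (injective_diversity TYPE('v + ('a set \<Rightarrow> real)) X \<delta> \<longleftrightarrow>
            (\<exists>\<phi>. diversity_isomorphism X \<delta> (tight_span X \<delta>) (tight_span_div X \<delta>) \<phi>))"
proof -
  interpret diversity X \<delta> by fact
  let ?inj = "injective_diversity TYPE('v + ('a set \<Rightarrow> real)) X \<delta>"
  let ?iso = "\<exists>\<phi>. diversity_isomorphism X \<delta> (tight_span X \<delta>) (tight_span_div X \<delta>) \<phi>"
  have "?inj" if "hyperconvex_diversity X \<delta>"
    unfolding injective_diversity_def using hyperconvex_imp_extension[OF that] by blast
  moreover have "hyperconvex_diversity X \<delta>" if ?inj
  proof -
    \<comment> \<open>send \<open>y\<close> to the indicator of \<open>{set_option y}\<close>; the point \<open>None\<close> gives the indicator of \<open>{{}}\<close>\<close>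
    let ?e = "\<lambda>y. Inr (\<lambda>A. of_bool (A = set_option y)) :: 'v + ('a set \<Rightarrow> real)"
    have "inj ?e"
    proof (rule injI)
      fix y y' :: "'a option" assume "?e y = ?e y'"
      then have "(\<lambda>A. of_bool (A = set_option y) :: real) = (\<lambda>A. of_bool (A = set_option y'))"
        by simp
      from fun_cong[OF this, of "set_option y"] have "set_option y = set_option y'"
        by (simp split: if_splits)
      then show "y = y'" by (cases y; cases y') auto
    qed
    then show ?thesis by (rule injective_imp_hyperconvex[OF that])
  qed
  moreover have ?iso if "hyperconvex_diversity X \<delta>"
    using hyperconvex_imp_canonical_isomorphism[OF that] by blast
  moreover have "hyperconvex_diversity X \<delta>" if ?iso
    using that isomorphic_diversity tight_span_hyperconvex isomorphic_hyperconvex by metis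
  ultimately show ?thesis by blast
qed

end
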